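(* Let $\{X_{k,i}; i \geq 1, k \geq 1\}$ be an array of i.i.d. random variables, write $X_i = X_{1,i}$ for $i \geq 1$, and let $\{p_n; n \geq 1\}$ be a sequence of positive integers such that $n/p_n$ is bounded away from $0$ and $\infty$. For $n \geq 2$ and $1 \leq i \leq p_n$ let $\bar{X}_i^{(n)} = \frac{1}{n}\sum_{k=1}^n X_{k,i}$, and for $1 \leq i, j \leq p_n$ let $$\hat{\rho}_{i,j}^{(n)} = \frac{\sum_{k=1}^n (X_{k,i} - \bar{X}_i^{(n)})(X_{k,j} - \bar{X}_j^{(n)})}{\big(\sum_{k=1}^n (X_{k,i} - \bar{X}_i^{(n)})^2\big)^{1/2} \big(\sum_{k=1}^n (X_{k,j} - \bar{X}_j^{(n)})^2\big)^{1/2}}$$ (the Pearson correlation coefficient between the columns $(X_{1,i},\dots,X_{n,i})'$ and $(X_{1,j},\dots,X_{n,j})'$), and let $L_n = \max_{1 \leq i < j \leq p_n} |\hat{\rho}_{i,j}^{(n)}|$. Let $1/2 < \alpha \leq 1$. If $X_{1,1}$ is nondegenerate and $$\sum_{n=1}^{\infty} P\Big(\max_{1 \leq i < j \leq n} |X_i X_j| \geq n^\alpha\Big) < \infty,$$ then $$\lim_{n \to \infty} n^{1-\alpha} L_n = 0 \quad \text{a.s.}$$ *)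

theory Defs
  imports "HOL-Probability.Probability"
begin

definition col_mean :: "(nat \<Rightarrow> nat \<Rightarrow> real) \<Rightarrow> nat \<Rightarrow> nat \<Rightarrow> real" where
  "col_mean x n i = (\<Sum>k=1..n. x k i) / real n"

text \<open>Pearson correlation coefficient between columns i and j (rows 1..n).
  Division by zero yields 0 (Isabelle convention).\<close>
definition pearson :: "(nat \<Rightarrow> nat \<Rightarrow> real) \<Rightarrow> nat \<Rightarrow> nat \<Rightarrow> nat \<Rightarrow> real" where
  "pearson x n i j =
     (\<Sum>k=1..n. (x k i - col_mean x n i) * (x k j - col_mean x n j)) /
     (sqrt (\<Sum>k=1..n. (x k i - col_mean x n i)^2) *
      sqrt (\<Sum>k=1..n. (x k j - col_mean x n j)^2))"

definition max_corr :: "(nat \<Rightarrow> nat \<Rightarrow> real) \<Rightarrow> nat \<Rightarrow> nat \<Rightarrow> real" where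
  "max_corr x n p = Max (insert 0 {\<bar>pearson x n i j\<bar> | i j. 1 \<le> i \<and> i < j \<and> j \<le> p})"

end

theory Submission
  imports Defs "HOL-Real_Asymp.Real_Asymp"
begin

text \<open>
  The hypothesis is only used through three consequences. Comparing one entry that exceeds a fixed
  level with the largest of the others turns it into \<open>\<Sum>n. n * P(\<bar>X\<bar> \<ge> n powr \<alpha> / c) < \<infinity>\<close>, which gives a
  finite second moment because \<open>\<alpha> \<le> 1\<close>. By Borel--Cantelli along dyadic blocks, almost surely for
  every \<open>\<delta> > 0\<close> all products \<open>X k i * X k j\<close> and all entries with \<open>k \<le> n\<close>, \<open>i \<noteq> j \<le> p n\<close> are eventually
  below \<open>\<delta> * n powr \<alpha>\<close>; exchangeability makes the rescalings needed here harmless.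

  For \<open>\<alpha> > 1/2\<close>, an exponential Chebyshev bound with parameter of order \<open>ln n / n powr \<alpha>\<close> shows that a sum of
  \<open>n\<close> independent centered variables of variance at most \<open>V\<close>, all bounded by \<open>\<delta> * n powr \<alpha>\<close>, exceeds
  \<open>\<epsilon> * n powr \<alpha>\<close> with probability at most \<open>6 / n ^ 4\<close> once \<open>\<delta>\<close> is small compared with \<open>\<epsilon>\<close>. A union bound
  over the pairs of columns then controls the numerators of all correlation coefficients at once,
  and the same bound applied to indicators keeps the denominators of order \<open>n\<close>.
\<close>

subsection \<open>Tails of truncated sums\<close>

text \<open>Second-order Taylor expansion with Lagrange remainder \<open>exp t / 2 * (l * x)\<close>
  squared over the second power: the intermediate point satisfies |t| \<le> |l x|, hence t \<le> l
  b. The factor 1/2 is given away.\<close>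

lemma exp_le_quadratic:
  fixes x b l :: real
  assumes "\<bar>x\<bar> \<le> b" "0 \<le> l"
  shows "exp (l * x) \<le> 1 + l * x + l\<^sup>2 * exp (l * b) * x\<^sup>2"
proof -
  obtain t where t: "\<bar>t\<bar> \<le> \<bar>l * x\<bar>" "exp (l * x) = (\<Sum>m<2. (l * x) ^ m / fact m) + exp t / fact 2 * (l * x) ^ 2"
    using Maclaurin_exp_le by blast
  have "l * \<bar>x\<bar> \<le> l * b" using assms by (intro mult_left_mono) auto
  then have "t \<le> l * b" using t(1) assms by (simp add: abs_mult)
  then have "exp t / 2 \<le> exp (l * b)"
    using exp_gt_zero[of t] exp_le_cancel_iff[of t "l * b"] by linarith
  then have "exp t / 2 * (l * x)\<^sup>2 \<le> exp (l * b) * (l * x)\<^sup>2"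
    by (rule mult_right_mono) simp
  then show ?thesis
    using t(2) by (simp add: numeral_2_eq_2 power_mult_distrib mult_ac)
qed

text \<open>Integrating the quadratic bound leaves 1 + u, and 1 + u \<le> exp u. In exponential form
  the bounds for independent summands multiply by adding exponents.\<close>

lemma (in prob_space) exp_moment_le:
  fixes W :: "'a \<Rightarrow> real"
  assumes [measurable]: "W \<in> borel_measurable M"
    and W2: "integrable M (\<lambda>\<omega>. (W \<omega>)\<^sup>2)"
    and bd: "\<And>\<omega>. \<bar>W \<omega>\<bar> \<le> b" and l: "0 \<le> l"
  shows "integrable M (\<lambda>\<omega>. exp (l * W \<omega>))"
    and "expectation (\<lambda>\<omega>. exp (l * W \<omega>)) \<le>
      exp (l * expectation W + l\<^sup>2 * exp (l * b) * expectation (\<lambda>\<omega>. (W \<omega>)\<^sup>2))"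
proof -
  have W1: "integrable M W"
    using W2 by (rule square_integrable_imp_integrable[rotated]) simp
  have lb: "l * W \<omega> \<le> l * b" for \<omega>
    using bd[of \<omega>] l by (intro mult_left_mono) auto
  show int: "integrable M (\<lambda>\<omega>. exp (l * W \<omega>))"
    by (rule integrable_const_bound[where B = "exp (l * b)"]) (use lb in auto)
  have "expectation (\<lambda>\<omega>. exp (l * W \<omega>)) \<le>
      expectation (\<lambda>\<omega>. 1 + l * W \<omega> + l\<^sup>2 * exp (l * b) * (W \<omega>)\<^sup>2)"
    by (rule integral_mono) (use int W1 W2 exp_le_quadratic[OF bd l] in auto)
  also have "\<dots> = 1 + (l * expectation W + l\<^sup>2 * exp (l * b) * expectation (\<lambda>\<omega>. (W \<omega>)\<^sup>2))"
    using W1 W2 by (simp add: prob_space)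
  also have "\<dots> \<le> exp (l * expectation W + l\<^sup>2 * exp (l * b) * expectation (\<lambda>\<omega>. (W \<omega>)\<^sup>2))"
    by (rule exp_ge_add_one_self)
  finally show "expectation (\<lambda>\<omega>. exp (l * W \<omega>)) \<le>
      exp (l * expectation W + l\<^sup>2 * exp (l * b) * expectation (\<lambda>\<omega>. (W \<omega>)\<^sup>2))" .
qed

text \<open>On the event all summands agree with their truncations at level b, so the exponential
  Markov inequality can be applied to the bounded truncated sum. The truncated variables are no
  longer centered; the term \<open>l * V / b\<close> pays for their bias.\<close>

lemma (in prob_space) chernoff_truncated:
  fixes Y :: "nat \<Rightarrow> 'a \<Rightarrow> real"
  assumes indep: "indep_vars (\<lambda>_. borel) Y {1..n}"
    and Y2: "\<And>k. k \<in> {1..n} \<Longrightarrow> integrable M (\<lambda>\<omega>. (Y k \<omega>)\<^sup>2)"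
    and Y0: "\<And>k. k \<in> {1..n} \<Longrightarrow> expectation (Y k) = 0"
    and V: "\<And>k. k \<in> {1..n} \<Longrightarrow> expectation (\<lambda>\<omega>. (Y k \<omega>)\<^sup>2) \<le> V"
    and b: "b > 0" and l: "l > 0"
  shows "prob {\<omega> \<in> space M. t \<le> (\<Sum>k=1..n. Y k \<omega>) \<and> (\<forall>k\<in>{1..n}. \<bar>Y k \<omega>\<bar> \<le> b)}
    \<le> exp (real n * (l * V / b + l\<^sup>2 * exp (l * b) * V) - l * t)"
proof -
  define c where "c x = (if \<bar>x\<bar> \<le> b then x else 0)" for x :: real
  have c_meas [measurable]: "c \<in> borel_measurable borel" unfolding c_def by measurable
  define W where "W k \<omega> = c (Y k \<omega>)" for k \<omega>
  have Ym [measurable]: "Y k \<in> borel_measurable M" if "k \<in> {1..n}" for k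
    using indep that by (auto simp: indep_vars_def)
  have Wm [measurable]: "W k \<in> borel_measurable M" if "k \<in> {1..n}" for k
    unfolding W_def using that by measurable
  have Wb: "\<bar>W k \<omega>\<bar> \<le> b" for k \<omega> using b by (auto simp: W_def c_def)
  have W2le: "(W k \<omega>)\<^sup>2 \<le> (Y k \<omega>)\<^sup>2" for k \<omega> by (auto simp: W_def c_def)
  have W2: "integrable M (\<lambda>\<omega>. (W k \<omega>)\<^sup>2)" if "k \<in> {1..n}" for k
    by (rule Bochner_Integration.integrable_bound[OF Y2[OF that]]) (use that W2le in auto)
  have W1: "integrable M (W k)" if "k \<in> {1..n}" for k
    using that by (intro square_integrable_imp_integrable[OF _ W2]) auto
  have Y1: "integrable M (Y k)" if "k \<in> {1..n}" for k
    using that by (intro square_integrable_imp_integrable[OF _ Y2]) auto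
  \<comment> \<open>Since Y has mean zero, the mean of W is the mean of W - Y. This difference
    vanishes where |Y| \<le> b and is at most |Y| \<le> Y^2 / b elsewhere.\<close>
  have EW: "expectation (W k) \<le> V / b" if k: "k \<in> {1..n}" for k
  proof -
    have "expectation (W k) = expectation (\<lambda>\<omega>. W k \<omega> - Y k \<omega>)"
      using Y0[OF k] W1[OF k] Y1[OF k] by simp
    also have "\<dots> \<le> expectation (\<lambda>\<omega>. (Y k \<omega>)\<^sup>2 / b)"
    proof (rule integral_mono)
      fix \<omega>
      have "b * \<bar>Y k \<omega>\<bar> \<le> \<bar>Y k \<omega>\<bar> * \<bar>Y k \<omega>\<bar>" if "\<bar>Y k \<omega>\<bar> > b"
        using that by (intro mult_right_mono) auto
      then have "\<bar>Y k \<omega>\<bar> \<le> (Y k \<omega>)\<^sup>2 / b" if "\<bar>Y k \<omega>\<bar> > b"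
        using b that by (simp add: field_simps power2_eq_square)
      then show "W k \<omega> - Y k \<omega> \<le> (Y k \<omega>)\<^sup>2 / b"
        using b by (auto simp: W_def c_def)
    qed (use W1[OF k] Y1[OF k] Y2[OF k] in auto)
    also have "\<dots> \<le> V / b" using V[OF k] b by (simp add: divide_right_mono)
    finally show ?thesis .
  qed
  have Wexp: "expectation (\<lambda>\<omega>. exp (l * W k \<omega>)) \<le> exp (l * V / b + l\<^sup>2 * exp (l * b) * V)"
    if k: "k \<in> {1..n}" for k
  proof -
    have "expectation (\<lambda>\<omega>. (W k \<omega>)\<^sup>2) \<le> V"
      using integral_mono[OF W2[OF k] Y2[OF k] W2le] V[OF k] by linarith
    then have "l * expectation (W k) + l\<^sup>2 * exp (l * b) * expectation (\<lambda>\<omega>. (W k \<omega>)\<^sup>2)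
        \<le> l * (V / b) + l\<^sup>2 * exp (l * b) * V"
      using EW[OF k] l by (intro add_mono mult_left_mono) auto
    then show ?thesis
      using exp_moment_le(2)[OF Wm[OF k] W2[OF k] Wb, of l] l by (smt (verit) exp_le_cancel_iff times_divide_eq_right)
  qed
  have iW: "indep_vars (\<lambda>_. borel) (\<lambda>k \<omega>. exp (l * W k \<omega>)) {1..n}"
    unfolding W_def by (rule indep_vars_compose2[OF indep, where Y = "\<lambda>_ x. exp (l * c x)"]) simp
  have ie: "integrable M (\<lambda>\<omega>. exp (l * W k \<omega>))" if "k \<in> {1..n}" for k
    using exp_moment_le(1)[OF Wm[OF that] W2[OF that] Wb] l by simp
  have ip: "integrable M (\<lambda>\<omega>. \<Prod>k\<in>{1..n}. exp (l * W k \<omega>))"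
    by (rule indep_vars_integrable[OF _ iW ie]) auto
  have "expectation (\<lambda>\<omega>. \<Prod>k\<in>{1..n}. exp (l * W k \<omega>)) = (\<Prod>k\<in>{1..n}. expectation (\<lambda>\<omega>. exp (l * W k \<omega>)))"
    by (rule indep_vars_lebesgue_integral[OF _ iW ie]) auto
  also have "\<dots> \<le> (\<Prod>k\<in>{1..n}. exp (l * V / b + l\<^sup>2 * exp (l * b) * V))"
    by (intro prod_mono conjI Wexp) auto
  also have "\<dots> = exp (real n * (l * V / b + l\<^sup>2 * exp (l * b) * V))"
    by (simp add: exp_of_nat_mult)
  finally have le: "expectation (\<lambda>\<omega>. \<Prod>k\<in>{1..n}. exp (l * W k \<omega>)) \<le> exp (real n * (l * V / b + l\<^sup>2 * exp (l * b) * V))" .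
  have "prob {\<omega> \<in> space M. t \<le> (\<Sum>k=1..n. Y k \<omega>) \<and> (\<forall>k\<in>{1..n}. \<bar>Y k \<omega>\<bar> \<le> b)}
      \<le> prob {\<omega> \<in> space M. exp (l * t) \<le> (\<Prod>k\<in>{1..n}. exp (l * W k \<omega>))}"
  proof (rule finite_measure_mono)
    show "{\<omega> \<in> space M. t \<le> (\<Sum>k=1..n. Y k \<omega>) \<and> (\<forall>k\<in>{1..n}. \<bar>Y k \<omega>\<bar> \<le> b)}
        \<subseteq> {\<omega> \<in> space M. exp (l * t) \<le> (\<Prod>k\<in>{1..n}. exp (l * W k \<omega>))}"
    proof safe
      fix \<omega> assume *: "t \<le> (\<Sum>k=1..n. Y k \<omega>)" "\<forall>k\<in>{1..n}. \<bar>Y k \<omega>\<bar> \<le> b"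
      have "(\<Sum>k=1..n. W k \<omega>) = (\<Sum>k=1..n. Y k \<omega>)"
        using *(2) by (intro sum.cong) (auto simp: W_def c_def)
      then show "exp (l * t) \<le> (\<Prod>k\<in>{1..n}. exp (l * W k \<omega>))"
        using *(1) l by (simp flip: exp_sum sum_distrib_left)
    qed
  qed (use ip in measurable)
  also have "\<dots> \<le> expectation (\<lambda>\<omega>. \<Prod>k\<in>{1..n}. exp (l * W k \<omega>)) / exp (l * t)"
    by (rule integral_Markov_inequality_measure[OF ip]) (auto intro!: prod_nonneg)
  also have "\<dots> \<le> exp (real n * (l * V / b + l\<^sup>2 * exp (l * b) * V)) / exp (l * t)"
    using le by (intro divide_right_mono) auto
  finally show ?thesis by (simp add: exp_diff)
qed

text \<open>The exponential bound is used with truncation level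
  \<open>b = \<delta> * real n powr \<alpha>\<close> and exponent of order ln n / b. As \<alpha> >
  1/2, b^2 exceeds n by the power n^(2 \<theta>), which makes the variance terms vanish, while l
  times the threshold equals 4 ln n. The threshold for n does not depend on Y, so the bound may be
  summed over many families at once; n^(-4) leaves n^(-2) after about n^2 pairs of columns.\<close>

lemma (in prob_space) truncated_tail_bound:
  fixes \<alpha> \<epsilon> V :: real
  assumes \<alpha>: "1/2 < \<alpha>" and \<epsilon>: "0 < \<epsilon>"
  shows "\<exists>\<delta>>0. \<forall>\<^sub>F n in sequentially. \<forall>Y. indep_vars (\<lambda>_. borel) Y {1..n} \<longrightarrow>
    (\<forall>k\<in>{1..n}. integrable M (\<lambda>\<omega>. (Y k \<omega>)\<^sup>2) \<and> expectation (Y k) = 0 \<and>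
      expectation (\<lambda>\<omega>. (Y k \<omega>)\<^sup>2) \<le> V) \<longrightarrow>
    prob {\<omega> \<in> space M. \<epsilon> * real n powr \<alpha> \<le> \<bar>\<Sum>k=1..n. Y k \<omega>\<bar> \<and>
      (\<forall>k\<in>{1..n}. \<bar>Y k \<omega>\<bar> \<le> \<delta> * real n powr \<alpha>)} \<le> 6 / real n ^ 4"
proof -
  define \<theta> where "\<theta> = \<alpha> - 1/2"
  \<comment> \<open>Chosen so that \<theta> \<epsilon> / \<delta> = 4, the power of 1/n wanted in
    the end.\<close>
  define \<delta> where "\<delta> = \<theta> * \<epsilon> / 4"
  have \<theta>: "\<theta> > 0" and \<delta>: "\<delta> > 0" using \<alpha> \<epsilon> by (auto simp: \<theta>_def \<delta>_def)
  have \<alpha>_eq: "\<alpha> = \<theta> + 1/2" by (simp add: \<theta>_def)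
  \<comment> \<open>These are the two positive terms of the exponent in the exponential bound, in
    the form in which \<open>e1\<close> and \<open>e2\<close> compute them below. Once their sum is
    below 1 they cost only a factor e.\<close>
  have "(\<lambda>x::real. V * \<theta> / \<delta>\<^sup>2 * (ln x * x powr (- 2 * \<theta>)) + V * \<theta>\<^sup>2 / \<delta>\<^sup>2 * ((ln x)\<^sup>2 * x powr (- \<theta>))) \<longlonglongrightarrow> 0"
    using \<theta> by real_asymp
  then have ev: "\<forall>\<^sub>F n in sequentially. V * \<theta> / \<delta>\<^sup>2 * (ln (real n) * real n powr (- 2 * \<theta>))
      + V * \<theta>\<^sup>2 / \<delta>\<^sup>2 * ((ln (real n))\<^sup>2 * real n powr (- \<theta>)) < 1"
    by (rule order_tendstoD) simp
  have main: "prob {\<omega> \<in> space M. \<epsilon> * real n powr \<alpha> \<le> (\<Sum>k=1..n. Y k \<omega>) \<and>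
      (\<forall>k\<in>{1..n}. \<bar>Y k \<omega>\<bar> \<le> \<delta> * real n powr \<alpha>)} \<le> 3 / real n ^ 4"
    if n: "n \<ge> 2" "V * \<theta> / \<delta>\<^sup>2 * (ln (real n) * real n powr (- 2 * \<theta>))
      + V * \<theta>\<^sup>2 / \<delta>\<^sup>2 * ((ln (real n))\<^sup>2 * real n powr (- \<theta>)) < 1"
      and Y: "indep_vars (\<lambda>_. borel) Y {1..n}" "\<And>k. k\<in>{1..n} \<Longrightarrow> integrable M (\<lambda>\<omega>. (Y k \<omega>)\<^sup>2)"
        "\<And>k. k\<in>{1..n} \<Longrightarrow> expectation (Y k) = 0"
        "\<And>k. k\<in>{1..n} \<Longrightarrow> expectation (\<lambda>\<omega>. (Y k \<omega>)\<^sup>2) \<le> V" for n Y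
  proof -
    define b where "b = \<delta> * real n powr \<alpha>"
    \<comment> \<open>With this l the factor \<open>exp (l * b)\<close> is only n^\<theta>, half of
      the surplus n^(2 \<theta>) contained in b^2 / n.\<close>
    define l where "l = \<theta> * ln (real n) / b"
    have b: "b > 0" using \<delta> n by (simp add: b_def)
    have l: "l > 0" using \<theta> b n by (simp add: l_def)
    have lb: "exp (l * b) = real n powr \<theta>" using b n by (simp add: l_def powr_def)
    have bb: "b * b = \<delta>\<^sup>2 * real n powr (2 * \<theta>) * real n"
    proof -
      have "real n powr \<alpha> * real n powr \<alpha> = real n powr (2 * \<theta> + 1)"
        by (simp add: powr_add[symmetric] \<alpha>_eq)
      then show ?thesis using n by (simp add: b_def power2_eq_square powr_add)
    qed
    have "real n * (l * V / b) = V * \<theta> * ln (real n) * real n / (b * b)"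
      using b by (simp add: l_def field_simps)
    also have "\<dots> = V * \<theta> / \<delta>\<^sup>2 * (ln (real n) * real n powr (- 2 * \<theta>))"
      using n \<delta> unfolding bb by (simp add: powr_minus field_simps)
    finally have e1: "real n * (l * V / b) = V * \<theta> / \<delta>\<^sup>2 * (ln (real n) * real n powr (- 2 * \<theta>))" .
    have "real n * (l\<^sup>2 * exp (l * b) * V) = V * \<theta>\<^sup>2 * (ln (real n))\<^sup>2 * real n * real n powr \<theta> / (b * b)"
      using b unfolding lb by (simp add: l_def field_simps power2_eq_square)
    also have "\<dots> = V * \<theta>\<^sup>2 / \<delta>\<^sup>2 * ((ln (real n))\<^sup>2 * (real n powr \<theta> / real n powr (2 * \<theta>)))"
      using n \<delta> unfolding bb by (simp add: field_simps)
    also have "real n powr \<theta> / real n powr (2 * \<theta>) = real n powr (- \<theta>)"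
      by (simp flip: powr_diff)
    finally have e2: "real n * (l\<^sup>2 * exp (l * b) * V) = V * \<theta>\<^sup>2 / \<delta>\<^sup>2 * ((ln (real n))\<^sup>2 * real n powr (- \<theta>))" .
    have lt: "l * (\<epsilon> * real n powr \<alpha>) = 4 * ln (real n)"
      using \<theta> \<epsilon> n by (simp add: l_def b_def \<delta>_def field_simps)
    have "prob {\<omega> \<in> space M. \<epsilon> * real n powr \<alpha> \<le> (\<Sum>k=1..n. Y k \<omega>) \<and> (\<forall>k\<in>{1..n}. \<bar>Y k \<omega>\<bar> \<le> b)}
      \<le> exp (real n * (l * V / b + l\<^sup>2 * exp (l * b) * V) - l * (\<epsilon> * real n powr \<alpha>))"
      by (rule chernoff_truncated[OF Y b l])
    also have "\<dots> \<le> exp (1 - 4 * ln (real n))"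
      using n(2) e1 e2 unfolding lt by (simp add: distrib_left)
    also have "\<dots> = exp 1 / real n ^ 4"
    proof -
      have "exp (4 * ln (real n)) = real n ^ 4"
        using n exp_of_nat_mult[of 4 "ln (real n)"] by simp
      then show ?thesis by (simp add: exp_diff)
    qed
    also have "\<dots> \<le> 3 / real n ^ 4"
      using exp_le by (intro divide_right_mono) auto
    finally show ?thesis by (simp add: b_def)
  qed
  have "\<forall>\<^sub>F n in sequentially. \<forall>Y. indep_vars (\<lambda>_. borel) Y {1..n} \<longrightarrow>
    (\<forall>k\<in>{1..n}. integrable M (\<lambda>\<omega>. (Y k \<omega>)\<^sup>2) \<and> expectation (Y k) = 0 \<and>
      expectation (\<lambda>\<omega>. (Y k \<omega>)\<^sup>2) \<le> V) \<longrightarrow>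
    prob {\<omega> \<in> space M. \<epsilon> * real n powr \<alpha> \<le> \<bar>\<Sum>k=1..n. Y k \<omega>\<bar> \<and>
      (\<forall>k\<in>{1..n}. \<bar>Y k \<omega>\<bar> \<le> \<delta> * real n powr \<alpha>)} \<le> 6 / real n ^ 4"
    using ev eventually_ge_at_top[of 2]
  proof (eventually_elim, intro allI impI)
    fix n Y
    assume n: "V * \<theta> / \<delta>\<^sup>2 * (ln (real n) * real n powr (- 2 * \<theta>))
      + V * \<theta>\<^sup>2 / \<delta>\<^sup>2 * ((ln (real n))\<^sup>2 * real n powr (- \<theta>)) < 1" "2 \<le> n"
      and iY: "indep_vars (\<lambda>_. borel) Y {1..n}"
      and Y: "\<forall>k\<in>{1..n}. integrable M (\<lambda>\<omega>. (Y k \<omega>)\<^sup>2) \<and> expectation (Y k) = 0 \<and>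
        expectation (\<lambda>\<omega>. (Y k \<omega>)\<^sup>2) \<le> V"
    have Ym [measurable]: "Y k \<in> borel_measurable M" if "k \<in> {1..n}" for k
      using iY that by (auto simp: indep_vars_def)
    let ?A = "\<lambda>Z. {\<omega> \<in> space M. \<epsilon> * real n powr \<alpha> \<le> (\<Sum>k=1..n. Z k \<omega>) \<and>
      (\<forall>k\<in>{1..n}. \<bar>Z k \<omega>\<bar> \<le> \<delta> * real n powr \<alpha>)}"
    \<comment> \<open>Applying the one-sided bound to Y and to -Y gives both tails, whence 6 = 3 +
      3, where 3 is an upper bound for e.\<close>
    have iN: "indep_vars (\<lambda>_. borel) (\<lambda>k \<omega>. - Y k \<omega>) {1..n}"
      using iY by (rule indep_vars_compose2[where Y = "\<lambda>_ x. - x"]) simp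
    have p1: "prob (?A Y) \<le> 3 / real n ^ 4"
      by (rule main[OF n(2,1) iY]) (use Y in auto)
    have p2: "prob (?A (\<lambda>k \<omega>. - Y k \<omega>)) \<le> 3 / real n ^ 4"
      by (rule main[OF n(2,1) iN]) (use Y in auto)
    have mA: "?A Y \<in> events" "?A (\<lambda>k \<omega>. - Y k \<omega>) \<in> events"
      by measurable
    have "prob {\<omega> \<in> space M. \<epsilon> * real n powr \<alpha> \<le> \<bar>\<Sum>k=1..n. Y k \<omega>\<bar> \<and>
      (\<forall>k\<in>{1..n}. \<bar>Y k \<omega>\<bar> \<le> \<delta> * real n powr \<alpha>)} \<le> prob (?A Y \<union> ?A (\<lambda>k \<omega>. - Y k \<omega>))"
    proof (rule finite_measure_mono)
      have "\<epsilon> * real n powr \<alpha> \<le> (\<Sum>k=1..n. Y k \<omega>) \<or> \<epsilon> * real n powr \<alpha> \<le> (\<Sum>k=1..n. - Y k \<omega>)"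
        if "\<epsilon> * real n powr \<alpha> \<le> \<bar>\<Sum>k=1..n. Y k \<omega>\<bar>" for \<omega>
        using that unfolding sum_negf by linarith
      then show "{\<omega> \<in> space M. \<epsilon> * real n powr \<alpha> \<le> \<bar>\<Sum>k=1..n. Y k \<omega>\<bar> \<and>
        (\<forall>k\<in>{1..n}. \<bar>Y k \<omega>\<bar> \<le> \<delta> * real n powr \<alpha>)} \<subseteq> ?A Y \<union> ?A (\<lambda>k \<omega>. - Y k \<omega>)"
        by fastforce
    qed (use mA in blast)
    also have "\<dots> \<le> prob (?A Y) + prob (?A (\<lambda>k \<omega>. - Y k \<omega>))"
      using mA by (rule measure_Un_le)
    finally show "prob {\<omega> \<in> space M. \<epsilon> * real n powr \<alpha> \<le> \<bar>\<Sum>k=1..n. Y k \<omega>\<bar> \<and>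
      (\<forall>k\<in>{1..n}. \<bar>Y k \<omega>\<bar> \<le> \<delta> * real n powr \<alpha>)} \<le> 6 / real n ^ 4"
      using p1 p2 by simp
  qed
  then show ?thesis using \<delta> by blast
qed

subsection \<open>Dyadic blocks\<close>

text \<open>A condensation argument without monotonicity of f: the disjoint block from 2^(m+1) to
  2^(m+2) has 2^(m+1) \<ge> 2^m indices, and on each of them f dominates g m, so the weighted sum of
  g is below the sum of f over all blocks.\<close>

lemma dyadic_summable:
  fixes f g :: "nat \<Rightarrow> real"
  assumes f: "summable f" "\<And>n. 0 \<le> f n" and g: "\<And>m. 0 \<le> g m"
    and le: "\<And>m n. 2 ^ (m + 1) < n \<Longrightarrow> n \<le> 2 ^ (m + 2) \<Longrightarrow> g m \<le> f n"
  shows "summable (\<lambda>m. 2 ^ m * g m)"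
proof (rule summableI_nonneg_bounded)
  fix L
  have blocks: "(\<Sum>m<L. \<Sum>n\<in>{2 ^ (m + 1)<..2 ^ (m + 2)}. f n) = (\<Sum>n\<in>{2<..2 ^ (L + 1)}. f n)"
  proof (induction L)
    case (Suc L)
    have "{2<..2 ^ (Suc L + 1)} = {2<..2 ^ (L + 1)} \<union> {2 ^ (L + 1)<..2 ^ (L + 2) :: nat}"
      by (subst ivl_disj_un_two(6)) auto
    then have "(\<Sum>n\<in>{2<..2 ^ (Suc L + 1)}. f n) =
        (\<Sum>n\<in>{2<..2 ^ (L + 1)}. f n) + (\<Sum>n\<in>{2 ^ (L + 1)<..2 ^ (L + 2)}. f n)"
      by (simp only:) (rule sum.union_disjoint, auto)
    then show ?case using Suc by simp
  qed simp
  have "(\<Sum>m<L. 2 ^ m * g m) \<le> (\<Sum>m<L. \<Sum>n\<in>{2 ^ (m + 1)<..2 ^ (m + 2)}. f n)"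
  proof (rule sum_mono)
    fix m
    have "2 ^ m * g m \<le> (\<Sum>n\<in>{2 ^ (m + 1)<..2 ^ (m + 2) :: nat}. g m)"
      using g[of m] by (simp add: mult_right_mono)
    also have "\<dots> \<le> (\<Sum>n\<in>{2 ^ (m + 1)<..2 ^ (m + 2)}. f n)"
      by (rule sum_mono) (use le in auto)
    finally show "2 ^ m * g m \<le> (\<Sum>n\<in>{2 ^ (m + 1)<..2 ^ (m + 2)}. f n)" .
  qed
  also have "\<dots> \<le> suminf f"
    unfolding blocks by (rule sum_le_suminf) (use f in auto)
  finally show "(\<Sum>m<L. 2 ^ m * g m) \<le> suminf f" .
qed (use g in auto)

text \<open>Borel--Cantelli is applied to one covering event per block, so only the probabilities of
  the \<open>B m\<close> have to be summed, not those of \<open>bad n\<close> for every n.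
  Measurability is needed for the covers alone.\<close>

lemma (in prob_space) AE_eventually_dyadic:
  fixes bad :: "nat \<Rightarrow> 'a \<Rightarrow> bool"
  assumes B [measurable]: "\<And>m. B m \<in> events" and summ: "summable (\<lambda>m. prob (B m))"
    and bad: "\<And>m n \<omega>. \<omega> \<in> space M \<Longrightarrow> 2 ^ m \<le> n \<Longrightarrow> n < 2 ^ (m + 1) \<Longrightarrow> bad n \<omega> \<Longrightarrow> \<omega> \<in> B m"
  shows "AE \<omega> in M. \<forall>\<^sub>F n in sequentially. \<not> bad n \<omega>"
proof -
  have "AE \<omega> in M. \<forall>\<^sub>F m in sequentially. \<omega> \<in> space M - B m"
    using summ by (intro borel_cantelli_AE1) (auto simp: emeasure_eq_measure)
  then show ?thesis
  proof eventually_elim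
    fix \<omega> assume "\<forall>\<^sub>F m in sequentially. \<omega> \<in> space M - B m"
    then obtain m1 where m1: "\<And>m. m \<ge> m1 \<Longrightarrow> \<omega> \<in> space M - B m"
      unfolding eventually_sequentially by blast
    have "\<not> bad n \<omega>" if n: "n \<ge> 2 ^ m1" for n
    proof -
      have "1 \<le> n" using n one_le_power[of "2::nat" m1] by linarith
      then obtain m where m: "2 ^ m \<le> n" "n < 2 ^ (m + 1)"
        using ex_power_ivl1[of 2 n] by auto
      have "(2::nat) ^ m1 < 2 ^ (m + 1)" using n m by linarith
      then have "m1 < m + 1" by (rule power_less_imp_less_exp[rotated]) simp
      then show ?thesis using bad[of \<omega> m n] m1[of m] m by auto
    qed
    then show "\<forall>\<^sub>F n in sequentially. \<not> bad n \<omega>"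
      unfolding eventually_sequentially by blast
  qed
qed

text \<open>Each additional doubling multiplies the level by 2^\<alpha> > 1, so finitely many
  doublings beat any constant a / \<delta>. Constants in front of n^\<alpha> can thus be traded for
  a shift s of the block index.\<close>

lemma dyadic_scale:
  fixes \<alpha> \<delta> a :: real
  assumes \<alpha>: "\<alpha> > 0" and \<delta>: "\<delta> > 0" and a: "a \<ge> 0"
  obtains s :: nat where "\<And>m n. n \<le> 2 ^ (m + 2) \<Longrightarrow> a * real n powr \<alpha> \<le> \<delta> * real (2 ^ (m + s + 2)) powr \<alpha>"
proof -
  have "1 < 2 powr \<alpha>" using \<alpha> by simp
  then obtain s :: nat where s: "a / \<delta> < (2 powr \<alpha>) ^ s" using real_arch_pow by blast
  have "a * real n powr \<alpha> \<le> \<delta> * real (2 ^ (m + s + 2)) powr \<alpha>" if n: "n \<le> 2 ^ (m + 2)" for m n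
  proof -
    have "real n \<le> real (2 ^ (m + 2))" using n by (rule of_nat_mono)
    then have "real n powr \<alpha> \<le> real (2 ^ (m + 2)) powr \<alpha>" using \<alpha> by (intro powr_mono2) auto
    then have "a * real n powr \<alpha> \<le> (\<delta> * (2 powr \<alpha>) ^ s) * real (2 ^ (m + 2)) powr \<alpha>"
      using s a \<delta> by (intro mult_mono) (auto simp: field_simps)
    also have "(2 powr \<alpha>) ^ s = real (2 ^ s) powr \<alpha>"
      by (simp add: powr_powr mult.commute flip: powr_realpow)
    also have "\<delta> * real (2 ^ s) powr \<alpha> * real (2 ^ (m + 2)) powr \<alpha> = \<delta> * real (2 ^ s * 2 ^ (m + 2)) powr \<alpha>"
      by (simp add: powr_mult)
    also have "(2::nat) ^ s * 2 ^ (m + 2) = 2 ^ (m + s + 2)" by (simp add: power_add)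
    finally show ?thesis .
  qed
  then show ?thesis by (rule that)
qed

subsection \<open>Nondegenerate random variables\<close>

text \<open>Otherwise the countably many events \<open>1 / real (Suc n) \<le> f \<omega>\<close>
  would all be null, and so would their union, the set where f is positive.\<close>

lemma (in prob_space) exists_prob_ge_pos:
  fixes f :: "'a \<Rightarrow> real"
  assumes [measurable]: "f \<in> borel_measurable M" and nonneg: "\<not> (AE \<omega> in M. f \<omega> \<le> 0)"
  shows "\<exists>c>0. 0 < prob {\<omega> \<in> space M. c \<le> f \<omega>}"
proof (rule ccontr)
  assume "\<not> ?thesis"
  then have zero: "prob {\<omega> \<in> space M. c \<le> f \<omega>} = 0" if "c > 0" for c
    using that by (auto simp: zero_less_measure_iff)
  have "AE \<omega> in M. \<not> 1 / real (Suc n) \<le> f \<omega>" for n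
    using zero[of "1 / real (Suc n)"]
    by (intro AE_I[where N = "{\<omega> \<in> space M. 1 / real (Suc n) \<le> f \<omega>}"]) (auto simp: emeasure_eq_measure)
  then have "AE \<omega> in M. \<forall>n. \<not> 1 / real (Suc n) \<le> f \<omega>" by (simp add: AE_all_countable)
  then have "AE \<omega> in M. f \<omega> \<le> 0"
  proof eventually_elim
    case (elim \<omega>)
    show ?case
    proof (rule ccontr)
      assume "\<not> f \<omega> \<le> 0"
      then obtain n where "1 / real (Suc n) < f \<omega>"
        using reals_Archimedean[of "f \<omega>"] by (auto simp: inverse_eq_divide)
      then show False using elim by (meson less_imp_le)
    qed
  qed
  then show False using nonneg by simp
qed

text \<open>A variable that almost surely stays at or above its mean has a nonnegative deviation
  with integral zero, hence is almost surely constant.\<close>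

lemma (in prob_space) exists_prob_below_mean:
  fixes Y :: "'a \<Rightarrow> real"
  assumes Y: "integrable M Y" and nondeg: "\<not> (AE \<omega> in M. Y \<omega> = expectation Y)"
  shows "\<exists>a<expectation Y. 0 < prob {\<omega> \<in> space M. Y \<omega> \<le> a}"
proof -
  define f where "f \<omega> = expectation Y - Y \<omega>" for \<omega>
  have [measurable]: "f \<in> borel_measurable M" unfolding f_def using Y by measurable
  have "\<not> (AE \<omega> in M. f \<omega> \<le> 0)"
  proof
    assume "AE \<omega> in M. f \<omega> \<le> 0"
    then have "AE \<omega> in M. 0 \<le> - f \<omega>" by eventually_elim simp
    moreover have "integrable M (\<lambda>\<omega>. - f \<omega>)" "expectation (\<lambda>\<omega>. - f \<omega>) = 0"
      using Y by (simp_all add: f_def prob_space)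
    ultimately have "AE \<omega> in M. - f \<omega> = 0"
      using integral_nonneg_eq_0_iff_AE[of M "\<lambda>\<omega>. - f \<omega>"] by blast
    then have "AE \<omega> in M. Y \<omega> = expectation Y" by eventually_elim (simp add: f_def)
    then show False using nondeg by simp
  qed
  then obtain c where c: "c > 0" "0 < prob {\<omega> \<in> space M. c \<le> f \<omega>}"
    using exists_prob_ge_pos[of f] by auto
  have "{\<omega> \<in> space M. c \<le> f \<omega>} = {\<omega> \<in> space M. Y \<omega> \<le> expectation Y - c}"
    by (auto simp: f_def)
  then show ?thesis using c by (intro exI[of _ "expectation Y - c"]) simp
qed

text \<open>The previous lemma for Y and for -Y yields mass strictly on either side of the mean. The
  gap is what later keeps the denominators of the correlations away from zero, since no centre is
  close to both sides.\<close>

lemma (in prob_space) nondegenerate_gap: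
  fixes Y :: "'a \<Rightarrow> real"
  assumes Y: "integrable M Y" and nondeg: "\<not> (\<exists>c. AE \<omega> in M. Y \<omega> = c)"
  obtains a b where "a < b" "0 < prob {\<omega> \<in> space M. Y \<omega> \<le> a}" "0 < prob {\<omega> \<in> space M. b \<le> Y \<omega>}"
proof -
  obtain a where a: "a < expectation Y" "0 < prob {\<omega> \<in> space M. Y \<omega> \<le> a}"
    using exists_prob_below_mean[OF Y] nondeg by blast
  have "\<not> (AE \<omega> in M. - Y \<omega> = expectation (\<lambda>\<omega>. - Y \<omega>))"
  proof
    assume "AE \<omega> in M. - Y \<omega> = expectation (\<lambda>\<omega>. - Y \<omega>)"
    then have "AE \<omega> in M. Y \<omega> = - expectation (\<lambda>\<omega>. - Y \<omega>)" by eventually_elim simp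
    then show False using nondeg by blast
  qed
  then obtain b where b: "b < expectation (\<lambda>\<omega>. - Y \<omega>)" "0 < prob {\<omega> \<in> space M. - Y \<omega> \<le> b}"
    using exists_prob_below_mean[of "\<lambda>\<omega>. - Y \<omega>"] Y by auto
  have "{\<omega> \<in> space M. - Y \<omega> \<le> b} = {\<omega> \<in> space M. - b \<le> Y \<omega>}" by auto
  then show ?thesis using that[of a "- b"] a b by simp
qed

subsection \<open>Correlation coefficients\<close>

text \<open>Sample means involve all rows and destroy independence. Centering at a fixed \<mu>
  restores a sum of terms depending on single rows; the correction is the product of two column sums
  divided by n.\<close>

lemma centered_cross_sum:
  fixes x :: "nat \<Rightarrow> nat \<Rightarrow> real"
  assumes n: "n \<ge> 1"
  shows "(\<Sum>k=1..n. (x k i - col_mean x n i) * (x k j - col_mean x n j)) =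
    (\<Sum>k=1..n. (x k i - \<mu>) * (x k j - \<mu>)) - (\<Sum>k=1..n. x k i - \<mu>) * (\<Sum>k=1..n. x k j - \<mu>) / real n"
proof -
  define z where "z k i = x k i - \<mu>" for k i
  define S where "S i = (\<Sum>k=1..n. z k i)" for i
  have mean: "x k i - col_mean x n i = z k i - S i / real n" for k i
    using n by (simp add: col_mean_def S_def z_def sum_subtractf field_simps)
  have "(\<Sum>k=1..n. (x k i - col_mean x n i) * (x k j - col_mean x n j)) =
    (\<Sum>k=1..n. z k i * z k j - S j / real n * z k i - S i / real n * z k j + S i / real n * (S j / real n))"
    unfolding mean by (intro sum.cong refl) (simp add: algebra_simps)
  also have "\<dots> = (\<Sum>k=1..n. z k i * z k j) - S j / real n * S i - S i / real n * S j
      + real n * (S i / real n * (S j / real n))"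
    unfolding sum.distrib sum_subtractf sum_distrib_left[symmetric] S_def[symmetric] by simp
  also have "\<dots> = (\<Sum>k=1..n. z k i * z k j) - S i * S j / real n"
    using n by (simp add: field_simps)
  finally show ?thesis by (simp only: S_def z_def)
qed

lemma pearson_bound:
  fixes x :: "nat \<Rightarrow> nat \<Rightarrow> real"
  assumes n: "n \<ge> 1" and \<kappa>: "\<kappa> > 0" and \<alpha>: "\<alpha> \<le> 1"
    and cross: "\<bar>\<Sum>k=1..n. (x k i - \<mu>) * (x k j - \<mu>)\<bar> \<le> e * real n powr \<alpha>"
    and sums: "\<bar>\<Sum>k=1..n. x k i - \<mu>\<bar> \<le> e * real n powr \<alpha>" "\<bar>\<Sum>k=1..n. x k j - \<mu>\<bar> \<le> e * real n powr \<alpha>"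
    and var: "\<kappa> * real n \<le> (\<Sum>k=1..n. (x k i - col_mean x n i)\<^sup>2)"
      "\<kappa> * real n \<le> (\<Sum>k=1..n. (x k j - col_mean x n j)\<^sup>2)"
  shows "real n powr (1 - \<alpha>) * \<bar>pearson x n i j\<bar> \<le> (e + e\<^sup>2) / \<kappa>"
proof -
  define N where "N = (\<Sum>k=1..n. (x k i - col_mean x n i) * (x k j - col_mean x n j))"
  define D where "D = sqrt (\<Sum>k=1..n. (x k i - col_mean x n i)\<^sup>2) * sqrt (\<Sum>k=1..n. (x k j - col_mean x n j)\<^sup>2)"
  have "\<kappa> * real n = sqrt (\<kappa> * real n) * sqrt (\<kappa> * real n)" using \<kappa> by simp
  \<comment> \<open>This also makes D positive, so the convention for division by zero does not
    interfere.\<close>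
  also have "\<dots> \<le> D" unfolding D_def using var \<kappa> by (intro mult_mono real_sqrt_le_mono) (auto intro: sum_nonneg)
  finally have D: "\<kappa> * real n \<le> D" .
  have prod: "\<bar>(\<Sum>k=1..n. x k i - \<mu>) * (\<Sum>k=1..n. x k j - \<mu>)\<bar> \<le> (e * real n powr \<alpha>) * (e * real n powr \<alpha>)"
    unfolding abs_mult using sums by (intro mult_mono) auto
  have "real n powr \<alpha> * real n powr \<alpha> = real n powr (\<alpha> + \<alpha>)" by (rule powr_add[symmetric])
  \<comment> \<open>Here \<alpha> \<le> 1 enters: the product of the two column sums has order n^(2
    \<alpha>) \<le> n^(\<alpha> + 1), so after division by n it is no larger than the cross
    sum.\<close>
  also have "\<dots> \<le> real n powr (\<alpha> + 1)" using n \<alpha> by (intro powr_mono) auto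
  also have "\<dots> = real n powr \<alpha> * real n" using n by (simp add: powr_add)
  finally have "e\<^sup>2 * (real n powr \<alpha> * real n powr \<alpha>) \<le> e\<^sup>2 * (real n powr \<alpha> * real n)"
    by (rule mult_left_mono) simp
  with prod have "\<bar>(\<Sum>k=1..n. x k i - \<mu>) * (\<Sum>k=1..n. x k j - \<mu>)\<bar> \<le> e\<^sup>2 * real n powr \<alpha> * real n"
    by (simp add: power2_eq_square mult_ac)
  then have "\<bar>(\<Sum>k=1..n. x k i - \<mu>) * (\<Sum>k=1..n. x k j - \<mu>) / real n\<bar> \<le> e\<^sup>2 * real n powr \<alpha>"
    using n by (simp add: field_simps)
  then have N: "\<bar>N\<bar> \<le> (e + e\<^sup>2) * real n powr \<alpha>"
    using cross unfolding N_def centered_cross_sum[OF n, of x i j \<mu>] distrib_right by linarith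
  have "\<bar>pearson x n i j\<bar> = \<bar>N\<bar> / D"
    using D \<kappa> unfolding pearson_def N_def D_def by (simp add: abs_mult sum_nonneg)
  also have "\<dots> \<le> ((e + e\<^sup>2) * real n powr \<alpha>) / (\<kappa> * real n)"
    using N D \<kappa> n by (intro frac_le) auto
  finally have "real n powr (1 - \<alpha>) * \<bar>pearson x n i j\<bar>
      \<le> real n powr (1 - \<alpha>) * (((e + e\<^sup>2) * real n powr \<alpha>) / (\<kappa> * real n))"
    by (rule mult_left_mono) simp
  also have "\<dots> = (e + e\<^sup>2) / \<kappa> * (real n powr (1 - \<alpha>) * real n powr \<alpha> / real n)" by simp
  also have "real n powr (1 - \<alpha>) * real n powr \<alpha> = real n" using n by (simp flip: powr_add)
  finally show ?thesis using n by simp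
qed

lemma finite_max_corr: "finite {\<bar>pearson x n i j\<bar> | i j. 1 \<le> i \<and> i < j \<and> j \<le> p}"
proof (rule finite_subset)
  show "{\<bar>pearson x n i j\<bar> | i j. 1 \<le> i \<and> i < j \<and> j \<le> p} \<subseteq> (\<lambda>(i, j). \<bar>pearson x n i j\<bar>) ` ({1..p} \<times> {1..p})"
    by fastforce
qed simp

lemma max_corr_nonneg: "0 \<le> max_corr x n p"
  unfolding max_corr_def by (rule Max_ge) (use finite_max_corr in auto)

lemma max_corr_le:
  assumes "0 \<le> b" "\<And>i j. 1 \<le> i \<Longrightarrow> i < j \<Longrightarrow> j \<le> p \<Longrightarrow> \<bar>pearson x n i j\<bar> \<le> b"
  shows "max_corr x n p \<le> b"
  unfolding max_corr_def using finite_max_corr[of x n p] assms by (subst Max_le_iff) auto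

subsection \<open>Arrays of i.i.d. random variables\<close>

locale iid_array = prob_space M for M :: "'a measure" +
  fixes X :: "nat \<Rightarrow> nat \<Rightarrow> 'a \<Rightarrow> real"
  assumes X_measurable [measurable]: "\<And>k i. X k i \<in> borel_measurable M"
    and X_indep: "indep_vars (\<lambda>_. borel) (\<lambda>(k, i). X k i) ({1..} \<times> {1..})"
    and X_ident: "\<And>k i. k \<ge> 1 \<Longrightarrow> i \<ge> 1 \<Longrightarrow> distr M borel (X k i) = distr M borel (X 1 1)"
begin

section \<open>Moments of entries and independence across rows\<close>

lemma entry_transfer:
  fixes f :: "real \<Rightarrow> real"
  assumes [measurable]: "f \<in> borel_measurable borel" and ki: "k \<ge> 1" "i \<ge> 1"
  shows "integrable M (\<lambda>\<omega>. f (X k i \<omega>)) \<longleftrightarrow> integrable M (\<lambda>\<omega>. f (X 1 1 \<omega>))"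
    and "expectation (\<lambda>\<omega>. f (X k i \<omega>)) = expectation (\<lambda>\<omega>. f (X 1 1 \<omega>))"
proof -
  have "integrable (distr M borel (X k i)) f \<longleftrightarrow> integrable (distr M borel (X 1 1)) f"
    using X_ident[OF ki] by simp
  then show "integrable M (\<lambda>\<omega>. f (X k i \<omega>)) \<longleftrightarrow> integrable M (\<lambda>\<omega>. f (X 1 1 \<omega>))"
    by (simp add: integrable_distr_eq)
  have "integral\<^sup>L (distr M borel (X k i)) f = integral\<^sup>L (distr M borel (X 1 1)) f"
    using X_ident[OF ki] by simp
  then show "expectation (\<lambda>\<omega>. f (X k i \<omega>)) = expectation (\<lambda>\<omega>. f (X 1 1 \<omega>))"
    by (simp add: integral_distr)
qed

lemma prob_entry:
  assumes "S \<in> sets borel" "k \<ge> 1" "i \<ge> 1"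
  shows "prob (X k i -` S \<inter> space M) = prob (X 1 1 -` S \<inter> space M)"
  using arg_cong[OF X_ident[OF assms(2,3)], of "\<lambda>D. measure D S"] assms(1)
  by (simp add: measure_distr)

text \<open>The blocks formed by columns i and j in different rows are disjoint, so functions of
  them are independent. The case i = j is included: the block is then a single entry, which also
  covers sums along one column.\<close>

lemma indep_vars_rows:
  assumes [measurable]: "g \<in> borel_measurable (borel \<Otimes>\<^sub>M borel)" and ij: "i \<ge> 1" "j \<ge> 1"
  shows "indep_vars (\<lambda>_. borel) (\<lambda>k \<omega>. g (X k i \<omega>, X k j \<omega>) :: real) {1..n}"
proof -
  let ?K = "\<lambda>k. {(k, i), (k, j)} :: (nat \<times> nat) set"
  have "indep_vars (\<lambda>k. PiM (?K k) (\<lambda>_. borel)) (\<lambda>k \<omega>. restrict (\<lambda>u. (case u of (k, i) \<Rightarrow> X k i) \<omega>) (?K k)) {1..n}"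
    by (rule indep_vars_restrict[OF X_indep]) (use ij in \<open>auto simp: disjoint_family_on_def\<close>)
  then have "indep_vars (\<lambda>_. borel) (\<lambda>k \<omega>. (\<lambda>z. g (z (k, i), z (k, j)))
      (restrict (\<lambda>u. (case u of (k, i) \<Rightarrow> X k i) \<omega>) (?K k))) {1..n}"
    by (rule indep_vars_compose2) measurable
  then show ?thesis by simp
qed

text \<open>Taken with x - \<mu> and with its square, this gives mean zero and the second moment of
  the products of centered entries.\<close>

lemma expectation_prod_entries:
  fixes f :: "real \<Rightarrow> real"
  assumes [measurable]: "f \<in> borel_measurable borel" and int: "integrable M (\<lambda>\<omega>. f (X 1 1 \<omega>))"
    and ij: "k \<ge> 1" "i \<ge> 1" "j \<ge> 1" "i \<noteq> j"
  shows "integrable M (\<lambda>\<omega>. f (X k i \<omega>) * f (X k j \<omega>))"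
    and "expectation (\<lambda>\<omega>. f (X k i \<omega>) * f (X k j \<omega>)) = (expectation (\<lambda>\<omega>. f (X 1 1 \<omega>)))\<^sup>2"
proof -
  let ?I = "{(k, i), (k, j)} :: (nat \<times> nat) set"
  have "indep_vars (\<lambda>_. borel) (\<lambda>(k, i). X k i) ?I"
    by (rule indep_vars_subset[OF X_indep]) (use ij in auto)
  then have ind: "indep_vars (\<lambda>_. borel) (\<lambda>u \<omega>. f ((case u of (k, i) \<Rightarrow> X k i) \<omega>)) ?I"
    by (rule indep_vars_compose2) simp
  have int': "integrable M (\<lambda>\<omega>. f ((case u of (k, i) \<Rightarrow> X k i) \<omega>))" if "u \<in> ?I" for u
    using that ij int entry_transfer(1)[of f k i] entry_transfer(1)[of f k j] by auto
  show "integrable M (\<lambda>\<omega>. f (X k i \<omega>) * f (X k j \<omega>))"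
    using indep_vars_integrable[OF _ ind int'] ij by simp
  show "expectation (\<lambda>\<omega>. f (X k i \<omega>) * f (X k j \<omega>)) = (expectation (\<lambda>\<omega>. f (X 1 1 \<omega>)))\<^sup>2"
  proof -
    have ne: "(k, i) \<noteq> (k, j)" using ij by simp
    have "expectation (\<lambda>\<omega>. f (X k i \<omega>) * f (X k j \<omega>))
        = expectation (\<lambda>\<omega>. \<Prod>u\<in>?I. f ((case u of (k, i) \<Rightarrow> X k i) \<omega>))"
      using ne by simp
    also have "\<dots> = (\<Prod>u\<in>?I. expectation (\<lambda>\<omega>. f ((case u of (k, i) \<Rightarrow> X k i) \<omega>)))"
      by (rule indep_vars_lebesgue_integral[OF _ ind int']) auto
    also have "\<dots> = expectation (\<lambda>\<omega>. f (X k i \<omega>)) * expectation (\<lambda>\<omega>. f (X k j \<omega>))"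
      using ne by simp
    also have "\<dots> = (expectation (\<lambda>\<omega>. f (X 1 1 \<omega>)))\<^sup>2"
      unfolding entry_transfer(2)[OF assms(1) ij(1,2)] entry_transfer(2)[OF assms(1) ij(1,3)]
      by (rule power2_eq_square[symmetric])
    finally show ?thesis .
  qed
qed

section \<open>Exchangeability of the events that some product is large\<close>

text \<open>Index sets are arbitrary sets of (row, column) positions, so that a row can be compared
  with any other set of entries, in particular with pieces of a longer row.\<close>

definition pair_event :: "(nat \<times> nat) set \<Rightarrow> real \<Rightarrow> 'a set" where
  "pair_event A t = {\<omega> \<in> space M. \<exists>u\<in>A. \<exists>v\<in>A. u \<noteq> v \<and>
    t \<le> \<bar>X (fst u) (snd u) \<omega> * X (fst v) (snd v) \<omega>\<bar>}"

lemma pair_event_measurable [measurable]: "finite A \<Longrightarrow> pair_event A t \<in> events"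
  unfolding pair_event_def by measurable

lemma pair_event_mono: "A \<subseteq> B \<Longrightarrow> s \<le> t \<Longrightarrow> pair_event A t \<subseteq> pair_event B s"
  unfolding pair_event_def using order_trans[of s t] by blast

text \<open>By independence and identical distribution the joint law of the whole array is a power
  of one law, and an injective reindexing of such a product measure is again a power of that
  law.\<close>

lemma distr_injective_family:
  assumes f: "inj_on f {..<n}" "f \<in> {..<n} \<rightarrow> {1..} \<times> {1..}"
  shows "distr M (\<Pi>\<^sub>M l\<in>{..<n}. borel) (\<lambda>\<omega>. \<lambda>l\<in>{..<n}. X (fst (f l)) (snd (f l)) \<omega>)
    = (\<Pi>\<^sub>M l\<in>{..<n}. distr M borel (X 1 1))"
proof -
  let ?I = "{1..} \<times> {1..} :: (nat \<times> nat) set"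
  let ?D = "distr M borel (X 1 1)"
  have "distr M (\<Pi>\<^sub>M u\<in>?I. borel) (\<lambda>\<omega>. \<lambda>u\<in>?I. (case u of (k, i) \<Rightarrow> X k i) \<omega>)
      = (\<Pi>\<^sub>M u\<in>?I. distr M borel (case u of (k, i) \<Rightarrow> X k i))"
    by (rule iffD1[OF indep_vars_iff_distr_eq_PiM' X_indep]) auto
  also have "\<dots> = (\<Pi>\<^sub>M u\<in>?I. ?D)"
    by (rule PiM_cong) (auto intro: X_ident simp del: One_nat_def)
  finally have joint: "distr M (\<Pi>\<^sub>M u\<in>?I. borel) (\<lambda>\<omega>. \<lambda>u\<in>?I. (case u of (k, i) \<Rightarrow> X k i) \<omega>) = (\<Pi>\<^sub>M u\<in>?I. ?D)" .
  have sets_eq: "sets (\<Pi>\<^sub>M l\<in>{..<n}. ?D) = sets (\<Pi>\<^sub>M l\<in>{..<n}. borel)"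
    by (rule sets_PiM_cong) auto
  have "(\<Pi>\<^sub>M l\<in>{..<n}. ?D) = distr (\<Pi>\<^sub>M u\<in>?I. ?D) (\<Pi>\<^sub>M l\<in>{..<n}. ?D) (\<lambda>z. \<lambda>l\<in>{..<n}. z (f l))"
    by (rule distr_PiM_reindex[symmetric]) (use f in \<open>auto intro!: prob_space_distr\<close>)
  also have "\<dots> = distr (\<Pi>\<^sub>M u\<in>?I. ?D) (\<Pi>\<^sub>M l\<in>{..<n}. borel) (\<lambda>z. \<lambda>l\<in>{..<n}. z (f l))"
    by (rule distr_cong[OF refl sets_eq refl])
  also have "\<dots> = distr M (\<Pi>\<^sub>M l\<in>{..<n}. borel)
      ((\<lambda>z. \<lambda>l\<in>{..<n}. z (f l)) \<circ> (\<lambda>\<omega>. \<lambda>u\<in>?I. (case u of (k, i) \<Rightarrow> X k i) \<omega>))"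
    unfolding joint[symmetric]
  proof (rule distr_distr)
    show "(\<lambda>z. \<lambda>l\<in>{..<n}. z (f l)) \<in> (\<Pi>\<^sub>M u\<in>?I. borel) \<rightarrow>\<^sub>M (\<Pi>\<^sub>M l\<in>{..<n}. borel)"
      by (rule measurable_restrict, rule measurable_component_singleton) (use f in auto)
    show "(\<lambda>\<omega>. \<lambda>u\<in>?I. (case u of (k, i) \<Rightarrow> X k i) \<omega>) \<in> M \<rightarrow>\<^sub>M (\<Pi>\<^sub>M u\<in>?I. borel)"
      by (rule measurable_restrict) (auto split: prod.split)
  qed
  also have "(\<lambda>z. \<lambda>l\<in>{..<n}. z (f l)) \<circ> (\<lambda>\<omega>. \<lambda>u\<in>?I. (case u of (k, i) \<Rightarrow> X k i) \<omega>)
      = (\<lambda>\<omega>. \<lambda>l\<in>{..<n}. X (fst (f l)) (snd (f l)) \<omega>)"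
  proof (intro ext)
    fix \<omega> l
    show "((\<lambda>z. \<lambda>l\<in>{..<n}. z (f l)) \<circ> (\<lambda>\<omega>. \<lambda>u\<in>?I. (case u of (k, i) \<Rightarrow> X k i) \<omega>)) \<omega> l
      = (\<lambda>l\<in>{..<n}. X (fst (f l)) (snd (f l)) \<omega>) l"
      using f(2) by (cases "l < n") (auto simp: Pi_iff split_beta)
  qed
  finally show ?thesis by (rule sym)
qed

text \<open>Exchangeability: after enumerating an index set of size n, the event becomes one fixed
  event under the n-fold product law, which does not remember the set.\<close>

lemma prob_pair_event_cong:
  assumes A: "finite A" "A \<subseteq> {1..} \<times> {1..}" and B: "finite B" "B \<subseteq> {1..} \<times> {1..}"
    and card: "card A = card B"
  shows "prob (pair_event A t) = prob (pair_event B t)"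
proof -
  \<comment> \<open>The right-hand side mentions C only through its size n.\<close>
  have *: "prob (pair_event C t) = measure (\<Pi>\<^sub>M l\<in>{..<n}. distr M borel (X 1 1))
      {z \<in> space (\<Pi>\<^sub>M l\<in>{..<n}. borel). \<exists>l\<in>{..<n}. \<exists>l'\<in>{..<n}. l \<noteq> l' \<and> t \<le> \<bar>z l * z l'\<bar>}"
    (is "_ = measure _ ?E")
    if C: "finite C" "C \<subseteq> {1..} \<times> {1..}" and n: "card C = n" for C n
  proof -
    obtain f where f: "bij_betw f {..<n} C"
      using ex_bij_betw_nat_finite[OF C(1)] n by (auto simp: atLeast0LessThan)
    have inj: "inj_on f {..<n}" and C_eq: "C = f ` {..<n}"
      using f by (auto simp: bij_betw_def)
    have d: "distr M (\<Pi>\<^sub>M l\<in>{..<n}. borel) (\<lambda>\<omega>. \<lambda>l\<in>{..<n}. X (fst (f l)) (snd (f l)) \<omega>)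
      = (\<Pi>\<^sub>M l\<in>{..<n}. distr M borel (X 1 1))"
      by (rule distr_injective_family[OF inj]) (use C C_eq in blast)
    have "measure (\<Pi>\<^sub>M l\<in>{..<n}. distr M borel (X 1 1)) ?E
       = prob ((\<lambda>\<omega>. \<lambda>l\<in>{..<n}. X (fst (f l)) (snd (f l)) \<omega>) -` ?E \<inter> space M)"
      unfolding d[symmetric]
      by (rule measure_distr) measurable
    also have "(\<lambda>\<omega>. \<lambda>l\<in>{..<n}. X (fst (f l)) (snd (f l)) \<omega>) -` ?E \<inter> space M = pair_event C t"
    proof -
      have "(\<lambda>\<omega>. \<lambda>l\<in>{..<n}. X (fst (f l)) (snd (f l)) \<omega>) -` ?E \<inter> space M =
          {\<omega> \<in> space M. \<exists>l\<in>{..<n}. \<exists>l'\<in>{..<n}. l \<noteq> l' \<and>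
            t \<le> \<bar>X (fst (f l)) (snd (f l)) \<omega> * X (fst (f l')) (snd (f l')) \<omega>\<bar>}"
        by (intro set_eqI) (simp add: space_PiM conj_commute cong: bex_cong_simp)
      also have "\<dots> = pair_event C t"
        unfolding C_eq pair_event_def bex_simps
        by (simp add: inj_on_eq_iff[OF inj] cong: bex_cong_simp)
      finally show ?thesis .
    qed
    finally show ?thesis by simp
  qed
  show ?thesis using *[OF A card] *[OF B refl] by simp
qed

lemma prob_pair_event_card_mono:
  assumes A: "finite A" "A \<subseteq> {1..} \<times> {1..}" and B: "finite B" "B \<subseteq> {1..} \<times> {1..}"
    and card: "card A \<le> card B"
  shows "prob (pair_event A t) \<le> prob (pair_event B t)"
proof -
  obtain C where C: "C \<subseteq> B" "card C = card A" "finite C"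
    using card by (rule obtain_subset_with_card_n)
  have "prob (pair_event A t) = prob (pair_event C t)"
    by (rule prob_pair_event_cong) (use A B C in auto)
  also have "\<dots> \<le> prob (pair_event B t)"
    using B C by (intro finite_measure_mono pair_event_mono pair_event_measurable) auto
  finally show ?thesis .
qed

text \<open>Cutting \<open>A\<close> into \<open>K\<close> blocks of size \<open>h\<close>, every pair lies in the union of two blocks.\<close>

lemma prob_pair_event_blocks:
  assumes A: "finite A" "A \<subseteq> {1..} \<times> {1..}" and B: "finite B" "B \<subseteq> {1..} \<times> {1..}"
    and h: "h > 0" and card: "card A \<le> K * h" "2 * h \<le> card B"
  shows "prob (pair_event A t) \<le> (real K)\<^sup>2 * prob (pair_event B t)"
proof -
  obtain f where f: "bij_betw f {..<card A} A"
    using ex_bij_betw_nat_finite[OF A(1)] by (auto simp: atLeast0LessThan)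
  define C where "C a = f ` {l \<in> {..<card A}. l div h = a}" for a
  have C_sub: "C a \<subseteq> A" for a using f by (auto simp: C_def bij_betw_def)
  have C_fin: "finite (C a)" for a by (auto simp: C_def)
  have C_card: "card (C a) \<le> h" for a
  proof -
    have "card (C a) \<le> card {l \<in> {..<card A}. l div h = a}"
      unfolding C_def by (rule card_image_le) simp
    also have "\<dots> \<le> card {a * h..<a * h + h}"
    proof (rule card_mono)
      show "{l \<in> {..<card A}. l div h = a} \<subseteq> {a * h..<a * h + h}"
        using h by (auto simp: dividend_less_div_times add.commute)
    qed simp
    finally show ?thesis by simp
  qed
  have cover: "\<exists>a<K. u \<in> C a" if "u \<in> A" for u
  proof -
    obtain l where l: "l < card A" "u = f l" using f \<open>u \<in> A\<close> by (auto simp: bij_betw_def)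
    have "l div h < K" using l card h by (simp add: less_mult_imp_div_less)
    then show ?thesis using l by (auto simp: C_def)
  qed
  have "pair_event A t \<subseteq> (\<Union>(a, b)\<in>{..<K} \<times> {..<K}. pair_event (C a \<union> C b) t)"
  proof
    fix \<omega> assume "\<omega> \<in> pair_event A t"
    then obtain u v where uv: "u \<in> A" "v \<in> A" "u \<noteq> v" "\<omega> \<in> space M"
      "t \<le> \<bar>X (fst u) (snd u) \<omega> * X (fst v) (snd v) \<omega>\<bar>"
      unfolding pair_event_def by blast
    obtain a b where "a < K" "u \<in> C a" "b < K" "v \<in> C b" using cover uv by metis
    with uv show "\<omega> \<in> (\<Union>(a, b)\<in>{..<K} \<times> {..<K}. pair_event (C a \<union> C b) t)"
      unfolding pair_event_def by auto
  qed
  then have "prob (pair_event A t) \<le> prob (\<Union>(a, b)\<in>{..<K} \<times> {..<K}. pair_event (C a \<union> C b) t)"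
    by (rule finite_measure_mono) (use C_fin in \<open>auto intro!: sets.finite_UN pair_event_measurable\<close>)
  also have "\<dots> \<le> (\<Sum>(a, b)\<in>{..<K} \<times> {..<K}. prob (pair_event (C a \<union> C b) t))"
    unfolding split_beta
    by (rule measure_UNION_le) (use C_fin in \<open>auto intro!: pair_event_measurable\<close>)
  also have "\<dots> \<le> (\<Sum>(a, b)\<in>{..<K} \<times> {..<K}. prob (pair_event B t))"
  proof (intro sum_mono, clarify, rule prob_pair_event_card_mono)
    fix a b
    show "card (C a \<union> C b) \<le> card B"
      using card_Un_le[of "C a" "C b"] C_card[of a] C_card[of b] card by linarith
    show "C a \<union> C b \<subseteq> {1..} \<times> {1..}" using C_sub A by blast
  qed (use C_fin B in auto)
  also have "\<dots> = (real K)\<^sup>2 * prob (pair_event B t)"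
    by (simp add: power2_eq_square)
  finally show ?thesis .
qed

lemma pair_event_row:
  "pair_event ({k} \<times> {1..n}) t = {\<omega> \<in> space M. \<exists>i\<in>{1..n}. \<exists>j\<in>{1..n}. i \<noteq> j \<and> t \<le> \<bar>X k i \<omega> * X k j \<omega>\<bar>}"
  unfolding pair_event_def by (auto simp del: One_nat_def)

section \<open>From large products to the tail and second moment of one entry\<close>

text \<open>If the first entry is at least c and one of the other n - 1 entries is at least t / c in
  absolute value, their product reaches t. Independence gives q (1 - (1 - G)^(n-1)) as a lower
  bound, and (1 - G)^(n-1) \<le> 1 / (1 + y) turns this into the stated inequality, multiplied out
  by 1 + y.\<close>

lemma prob_pair_event_ge:
  fixes c t :: real
  assumes n: "n \<ge> 2"
  defines "q \<equiv> prob {\<omega> \<in> space M. c \<le> \<bar>X 1 1 \<omega>\<bar>}"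
    and "y \<equiv> real (n - 1) * prob {\<omega> \<in> space M. t / c \<le> \<bar>X 1 1 \<omega>\<bar>}"
  assumes c: "c > 0" and t: "t \<ge> 0"
  shows "q * y \<le> prob (pair_event ({1} \<times> {1..n}) t) * (1 + y)"
proof -
  define G where "G = prob {\<omega> \<in> space M. t / c \<le> \<bar>X 1 1 \<omega>\<bar>}"
  let ?T = "prob (pair_event ({1} \<times> {1..n}) t)"
  \<comment> \<open>The intersection of these conditions along the row is the event that the first
    entry is at least c while all others stay below t / c; its probability factorizes.\<close>
  define S where "S u = (if u = (1, 1) then {x. c \<le> \<bar>x\<bar>} else {x. \<bar>x\<bar> < t / c})" for u :: "nat \<times> nat"
  let ?J = "{1} \<times> {1..n} :: (nat \<times> nat) set"
  let ?A = "(\<Inter>u\<in>?J. (case u of (k, i) \<Rightarrow> X k i) -` S u \<inter> space M)"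
  have S [measurable]: "S u \<in> sets borel" for u unfolding S_def by (cases "u = (1, 1)") simp_all
  have "prob ?A = (\<Prod>u\<in>?J. prob ((case u of (k, i) \<Rightarrow> X k i) -` S u \<inter> space M))"
    by (rule indep_varsD[OF X_indep]) (use n in auto)
  also have "\<dots> = (\<Prod>u\<in>?J. prob (X 1 1 -` S u \<inter> space M))"
  proof (rule prod.cong[OF refl])
    fix u assume "u \<in> ?J"
    then show "prob ((case u of (k, i) \<Rightarrow> X k i) -` S u \<inter> space M) = prob (X 1 1 -` S u \<inter> space M)"
      using prob_entry[OF S, of "fst u" "snd u" u] by (auto simp: split_beta)
  qed
  also have "\<dots> = (\<Prod>u\<in>insert (1, 1) ({1} \<times> {2..n}). prob (X 1 1 -` S u \<inter> space M))"
    using n by (intro prod.cong) auto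
  also have "\<dots> = prob (X 1 1 -` S (1, 1) \<inter> space M) * (\<Prod>u\<in>{1} \<times> {2..n}. prob (X 1 1 -` S u \<inter> space M))"
    by (rule prod.insert) auto
  also have "prob (X 1 1 -` S (1, 1) \<inter> space M) = q"
    unfolding q_def S_def by (rule arg_cong[where f = prob]) auto
  also have "(\<Prod>u\<in>{1} \<times> {2..n}. prob (X 1 1 -` S u \<inter> space M)) = (\<Prod>u\<in>{1::nat} \<times> {2..n}. 1 - G)"
  proof (rule prod.cong[OF refl])
    fix u :: "nat \<times> nat" assume u: "u \<in> {1} \<times> {2..n}"
    have "prob (X 1 1 -` S u \<inter> space M) = prob (space M - {\<omega> \<in> space M. t / c \<le> \<bar>X 1 1 \<omega>\<bar>})"
      using u by (intro arg_cong[where f = prob]) (auto simp: S_def)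
    also have "\<dots> = 1 - G" unfolding G_def by (rule prob_compl) measurable
    finally show "prob (X 1 1 -` S u \<inter> space M) = 1 - G" .
  qed
  also have "\<dots> = (1 - G) ^ (n - 1)" using n by simp
  finally have A: "prob ?A = q * (1 - G) ^ (n - 1)" .
  have A_ev: "?A \<in> events"
    using n by (intro sets.finite_INT) (auto intro!: measurable_sets[OF _ S] split: prod.split)
  \<comment> \<open>When the first entry is large, either all the others are small or some product
    with the first entry is large.\<close>
  have "{\<omega> \<in> space M. c \<le> \<bar>X 1 1 \<omega>\<bar>} \<subseteq> ?A \<union> pair_event ?J t"
  proof
    fix \<omega> assume "\<omega> \<in> {\<omega> \<in> space M. c \<le> \<bar>X 1 1 \<omega>\<bar>}"
    then have \<omega>: "\<omega> \<in> space M" "c \<le> \<bar>X 1 1 \<omega>\<bar>" by auto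
    show "\<omega> \<in> ?A \<union> pair_event ?J t"
    proof (cases "\<omega> \<in> pair_event ?J t")
      case False
      have small: "\<bar>X 1 i \<omega>\<bar> < t / c" if i: "i \<in> {1..n}" "i \<noteq> 1" for i
      proof (rule ccontr)
        assume "\<not> ?thesis"
        then have "c * (t / c) \<le> \<bar>X 1 1 \<omega>\<bar> * \<bar>X 1 i \<omega>\<bar>" using \<omega> c t by (intro mult_mono) auto
        then have "t \<le> \<bar>X 1 1 \<omega> * X 1 i \<omega>\<bar>" using c by (simp add: abs_mult)
        then have "\<omega> \<in> pair_event ?J t"
          unfolding pair_event_row using \<omega>(1) i n
          by (intro CollectI conjI bexI[of _ 1] bexI[of _ i]) auto
        then show False using False by blast
      qed
      have "\<omega> \<in> (case u of (k, i) \<Rightarrow> X k i) -` S u \<inter> space M" if "u \<in> ?J" for u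
      proof -
        obtain i where u: "u = (1, i)" "i \<in> {1..n}" using \<open>u \<in> ?J\<close> by auto
        show ?thesis
          using \<omega> small[OF u(2)] unfolding u(1) by (cases "i = 1") (auto simp: S_def)
      qed
      then show ?thesis by blast
    qed simp
  qed
  then have "q \<le> prob (?A \<union> pair_event ?J t)"
    unfolding q_def by (rule finite_measure_mono) (use A_ev in \<open>auto intro: pair_event_measurable\<close>)
  also have "\<dots> \<le> prob ?A + ?T"
    using A_ev by (rule measure_Un_le) (auto intro: pair_event_measurable)
  finally have q: "q \<le> q * (1 - G) ^ (n - 1) + ?T" unfolding A .
  have G: "0 \<le> G" "G \<le> 1" by (simp_all add: G_def)
  have y_def': "y = real (n - 1) * G" by (simp add: y_def G_def)
  have "(1 - G) ^ (n - 1) \<le> exp (- G) ^ (n - 1)"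
    using G exp_ge_add_one_self[of "- G"] by (intro power_mono) auto
  also have "\<dots> = exp (- y)" by (simp add: y_def' flip: exp_of_nat_mult)
  \<comment> \<open>Combines (1 - G)^(n-1) \<le> exp (-y) with 1 + y \<le> exp y.\<close>
  finally have "(1 - G) ^ (n - 1) * (1 + y) \<le> exp (- y) * exp y"
    using G exp_ge_add_one_self[of y] by (intro mult_mono) (auto simp: y_def')
  then have e: "(1 - G) ^ (n - 1) * (1 + y) \<le> 1" by (simp flip: exp_add)
  have "q * (1 + y) \<le> (q * (1 - G) ^ (n - 1) + ?T) * (1 + y)"
    using q G by (intro mult_right_mono) (auto simp: y_def')
  also have "\<dots> = q * ((1 - G) ^ (n - 1) * (1 + y)) + ?T * (1 + y)" by (simp add: algebra_simps)
  also have "\<dots> \<le> q * 1 + ?T * (1 + y)"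
    using e by (intro add_mono mult_left_mono) (auto simp: q_def)
  finally show ?thesis by (simp add: algebra_simps)
qed

text \<open>The terms T n of the given series tend to zero, so eventually T n < q / 2 and the part T
  n * y on the right of the comparison is absorbed into q y. What remains is y \<le> 2 T n /
  q.\<close>

lemma tail_summable:
  assumes c: "c > 0" and q: "prob {\<omega> \<in> space M. c \<le> \<bar>X 1 1 \<omega>\<bar>} > 0"
    and summ: "summable (\<lambda>n. prob (pair_event ({1} \<times> {1..n}) (real n powr \<alpha>)))"
  shows "summable (\<lambda>n. real n * prob {\<omega> \<in> space M. real n powr \<alpha> / c \<le> \<bar>X 1 1 \<omega>\<bar>})"
proof -
  define q where "q = prob {\<omega> \<in> space M. c \<le> \<bar>X 1 1 \<omega>\<bar>}"
  define T where "T n = prob (pair_event ({1} \<times> {1..n}) (real n powr \<alpha>))" for n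
  define G where "G n = prob {\<omega> \<in> space M. real n powr \<alpha> / c \<le> \<bar>X 1 1 \<omega>\<bar>}" for n
  have q0: "q > 0" using q by (simp add: q_def)
  have sT: "summable T" using summ by (simp add: T_def[abs_def])
  have "\<forall>\<^sub>F n in sequentially. T n < q / 2"
    using summable_LIMSEQ_zero[OF sT] q0 by (intro order_tendstoD(2)) auto
  then have "\<forall>\<^sub>F n in sequentially. norm (real n * G n) \<le> 4 / q * T n"
    using eventually_ge_at_top[of 2]
  proof eventually_elim
    case (elim n)
    define y where "y = real (n - 1) * G n"
    have y0: "y \<ge> 0" by (simp add: y_def G_def)
    have "q * y \<le> T n * (1 + y)"
      unfolding q_def y_def T_def G_def
      by (rule prob_pair_event_ge) (use elim c in auto)
    also have "\<dots> \<le> T n + q / 2 * y"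
      using elim y0 mult_right_mono[of "T n" "q / 2" y] by (simp add: algebra_simps)
    finally have y: "y \<le> 2 / q * T n" using q0 by (simp add: field_simps)
    \<comment> \<open>n \<le> 2 (n - 1) for n \<ge> 2; this is the second factor 2 in the constant 4
      / q.\<close>
    have "real n * G n \<le> (2 * real (n - 1)) * G n"
      using elim by (intro mult_right_mono) (auto simp: G_def)
    also have "\<dots> = 2 * y" by (simp add: y_def)
    finally have "real n * G n \<le> 2 * y" .
    moreover have "G n \<ge> 0" by (simp add: G_def)
    ultimately have "norm (real n * G n) \<le> 2 * y" by simp
    then show ?case using y by simp
  qed
  then have "summable (\<lambda>n. real n * G n)"
    by (rule summable_comparison_test_ev) (use sT in \<open>auto intro: summable_mult\<close>)
  then show ?thesis by (simp add: G_def)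
qed

text \<open>Layer-cake estimate: the square of a nonnegative U is at most the sum of 2 n + 1 over
  all n \<le> U, since the first L odd numbers add up to L^2. The given series controls the expected
  sum because n^\<alpha> \<le> n for \<alpha> \<le> 1.\<close>

lemma square_integrable_entry:
  assumes c: "c > 0" and \<alpha>: "\<alpha> \<le> 1"
    and summ: "summable (\<lambda>n. real n * prob {\<omega> \<in> space M. real n powr \<alpha> / c \<le> \<bar>X 1 1 \<omega>\<bar>})"
  shows "integrable M (\<lambda>\<omega>. (X 1 1 \<omega>)\<^sup>2)"
proof -
  \<comment> \<open>Scaling by c makes \<open>real n \<le> U \<omega>\<close> the event |X| \<ge> n
    / c, which matches the levels of the series.\<close>
  define U where "U \<omega> = c * \<bar>X 1 1 \<omega>\<bar>" for \<omega>
  have U [measurable]: "U \<in> borel_measurable M" unfolding U_def by measurable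
  define B where "B n = {\<omega> \<in> space M. real n \<le> U \<omega>}" for n
  have B [measurable]: "B n \<in> events" for n unfolding B_def by measurable
  have "summable (\<lambda>n. real (2 * n + 1) * prob (B n))"
  proof (rule summable_comparison_test_ev)
    show "\<forall>\<^sub>F n in sequentially. norm (real (2 * n + 1) * prob (B n)) \<le>
        3 * (real n * prob {\<omega> \<in> space M. real n powr \<alpha> / c \<le> \<bar>X 1 1 \<omega>\<bar>})"
      using eventually_ge_at_top[of 1]
    proof eventually_elim
      case (elim n)
      have "real n powr \<alpha> \<le> real n powr 1" using elim \<alpha> by (intro powr_mono) auto
      then have "B n \<subseteq> {\<omega> \<in> space M. real n powr \<alpha> / c \<le> \<bar>X 1 1 \<omega>\<bar>}"
        using c by (auto simp: B_def U_def field_simps)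
      then have "prob (B n) \<le> prob {\<omega> \<in> space M. real n powr \<alpha> / c \<le> \<bar>X 1 1 \<omega>\<bar>}"
        by (rule finite_measure_mono) measurable
      then have "real (2 * n + 1) * prob (B n) \<le> (3 * real n) * prob {\<omega> \<in> space M. real n powr \<alpha> / c \<le> \<bar>X 1 1 \<omega>\<bar>}"
        using elim by (intro mult_mono) auto
      then show ?case by (simp add: mult.assoc)
    qed
  qed (use summ in \<open>rule summable_mult\<close>)
  then have fin: "(\<Sum>n. ennreal (real (2 * n + 1) * prob (B n))) < \<infinity>"
    by (subst suminf_ennreal2) auto
  have "(\<integral>\<^sup>+\<omega>. ennreal ((U \<omega>)\<^sup>2) \<partial>M) \<le> (\<integral>\<^sup>+\<omega>. (\<Sum>n. ennreal (real (2 * n + 1)) * indicator (B n) \<omega>) \<partial>M)"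
  proof (rule nn_integral_mono)
    fix \<omega> assume \<omega>: "\<omega> \<in> space M"
    have U0: "U \<omega> \<ge> 0" using c by (simp add: U_def)
    \<comment> \<open>The least convenient integer above U for which every n < L still satisfies n
      \<le> U, so that all indicators below L equal 1.\<close>
    define L where "L = nat \<lfloor>U \<omega>\<rfloor> + 1"
    have L: "U \<omega> \<le> real L" using U0 by (simp add: L_def) linarith
    have sq: "(\<Sum>n<k. 2 * n + 1) = k\<^sup>2" for k :: nat
      by (induction k) (auto simp: power2_eq_square)
    have "(U \<omega>)\<^sup>2 \<le> (real L)\<^sup>2" using U0 L by (intro power_mono) auto
    also have "\<dots> = real (\<Sum>n<L. 2 * n + 1)" by (simp only: sq of_nat_power)
    also have "\<dots> = (\<Sum>n<L. real (2 * n + 1) * indicator (B n) \<omega>)"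
      unfolding of_nat_sum
    proof (rule sum.cong[OF refl])
      fix n assume "n \<in> {..<L}"
      then have "real n \<le> real (nat \<lfloor>U \<omega>\<rfloor>)" by (simp add: L_def)
      also have "\<dots> \<le> U \<omega>" using U0 by (rule of_nat_floor)
      finally have "real n \<le> U \<omega>" .
      then show "real (2 * n + 1) = real (2 * n + 1) * indicator (B n) \<omega>"
        using \<omega> by (simp add: B_def)
    qed
    finally have "ennreal ((U \<omega>)\<^sup>2) \<le> ennreal (\<Sum>n<L. real (2 * n + 1) * indicator (B n) \<omega>)"
      by (rule ennreal_leI)
    also have "\<dots> = (\<Sum>n<L. ennreal (real (2 * n + 1) * indicator (B n) \<omega>))"
      by (rule sum_ennreal[symmetric]) simp
    also have "\<dots> = (\<Sum>n<L. ennreal (real (2 * n + 1)) * indicator (B n) \<omega>)"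
      by (rule sum.cong) (auto simp: indicator_def)
    also have "\<dots> \<le> (\<Sum>n. ennreal (real (2 * n + 1)) * indicator (B n) \<omega>)"
      by (rule sum_le_suminf) auto
    finally show "ennreal ((U \<omega>)\<^sup>2) \<le> (\<Sum>n. ennreal (real (2 * n + 1)) * indicator (B n) \<omega>)" .
  qed
  also have "\<dots> = (\<Sum>n. ennreal (real (2 * n + 1) * prob (B n)))"
    by (subst nn_integral_suminf) (auto simp: nn_integral_cmult emeasure_eq_measure ennreal_mult simp del: of_nat_add of_nat_mult)
  also note fin
  finally have "integrable M (\<lambda>\<omega>. (U \<omega>)\<^sup>2)"
    by (intro integrableI_nonneg) auto
  then have "integrable M (\<lambda>\<omega>. (U \<omega>)\<^sup>2 / c\<^sup>2)" by simp
  then show ?thesis using c by (simp add: U_def power_mult_distrib)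
qed

section \<open>Almost sure bounds for all products and all entries\<close>

text \<open>A union over the at most 2^(m+1) rows of a dyadic block costs the weight that the dyadic
  summation supplies. Both discrepancies with the hypothesis cost only constants: the factor
  \<delta> is removed by shifting the block index, and the number of columns, of order 2^m, by
  cutting the row into pieces.\<close>

lemma AE_products_small:
  fixes p :: "nat \<Rightarrow> nat" and C :: nat
  assumes summ: "summable (\<lambda>n. prob (pair_event ({1} \<times> {1..n}) (real n powr \<alpha>)))"
    and \<alpha>: "\<alpha> > 0" and \<delta>: "\<delta> > 0" and p: "\<And>n. n \<ge> 1 \<Longrightarrow> p n \<le> C * n"
  shows "AE \<omega> in M. \<forall>\<^sub>F n in sequentially. \<not> (\<exists>k\<in>{1..n}. \<exists>i\<in>{1..p n}. \<exists>j\<in>{1..p n}.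
    i \<noteq> j \<and> \<delta> * real n powr \<alpha> \<le> \<bar>X k i \<omega> * X k j \<omega>\<bar>)"
proof -
  obtain s where s: "\<And>m n. n \<le> 2 ^ (m + 2) \<Longrightarrow> 1 * real n powr \<alpha> \<le> \<delta> * real (2 ^ (m + s + 2)) powr \<alpha>"
    using dyadic_scale[OF \<alpha> \<delta>, of 1] by auto
  \<comment> \<open>With pieces of length 2^m, a row of 2 C 2^(m+s+2) entries has K pieces, and two
    pieces have 2^(m+1) < n entries, so they fit into the row of length n of the hypothesis.\<close>
  define K where "K = 2 * C * 2 ^ (s + 2)"
  define u where "u m = prob (pair_event ({1} \<times> {1..2 * C * 2 ^ m}) (\<delta> * real (2 ^ m) powr \<alpha>))" for m :: nat
  \<comment> \<open>Adding 1 avoids a zero denominator when C = 0.\<close>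
  define g where "g m = u (m + s + 2) / ((real K)\<^sup>2 + 1)" for m
  have u0: "0 \<le> u m" for m by (simp add: u_def)
  have "summable (\<lambda>m. 2 ^ m * g m)"
  proof (rule dyadic_summable[OF summ])
    fix m n :: nat assume n: "2 ^ (m + 1) < n" "n \<le> 2 ^ (m + 2)"
    have "u (m + s + 2) \<le> (real K)\<^sup>2 * prob (pair_event ({1} \<times> {1..n}) (\<delta> * real (2 ^ (m + s + 2)) powr \<alpha>))"
      unfolding u_def
      by (rule prob_pair_event_blocks[where h = "2 ^ m"])
        (use n in \<open>auto simp: K_def power_add card_cartesian_product\<close>)
    also have "\<dots> \<le> ((real K)\<^sup>2 + 1) * prob (pair_event ({1} \<times> {1..n}) (real n powr \<alpha>))"
      using s[OF n(2)]
      by (intro mult_mono finite_measure_mono pair_event_mono pair_event_measurable) auto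
    finally show "g m \<le> prob (pair_event ({1} \<times> {1..n}) (real n powr \<alpha>))"
      unfolding g_def by (subst pos_divide_le_eq) (auto simp: mult.commute add_nonneg_pos)
  qed (auto simp: g_def u0)
  then have "summable (\<lambda>m. (2 ^ (s + 3) * ((real K)\<^sup>2 + 1)) * (2 ^ m * g m))"
    by (rule summable_mult)
  moreover have "(2 ^ (s + 3) * ((real K)\<^sup>2 + 1)) * (2 ^ m * g m) = 2 ^ (m + (s + 2) + 1) * u (m + (s + 2))" for m
  proof -
    have "((real K)\<^sup>2 + 1) * g m = u (m + s + 2)"
      unfolding g_def by (subst times_divide_eq_right) (simp add: add_nonneg_eq_0_iff)
    moreover have "2 ^ (s + 3) * a * (2 ^ m * z) = 2 ^ (m + (s + 2) + 1) * (a * z)" for a z :: real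
      by (simp add: power_add)
    ultimately show ?thesis by (simp only: add.assoc)
  qed
  ultimately have su: "summable (\<lambda>m. 2 ^ (m + 1) * u m)"
    using summable_iff_shift[of "\<lambda>m. 2 ^ (m + 1) * u m" "s + 2"] by simp
  \<comment> \<open>The cover of the whole block uses its extreme values: the most rows, the most
    columns and the lowest level.\<close>
  define B where "B m = (\<Union>k\<in>{1..2 ^ (m + 1)}. pair_event ({k} \<times> {1..2 * C * 2 ^ m}) (\<delta> * real (2 ^ m) powr \<alpha>))" for m :: nat
  have B: "B m \<in> events" for m unfolding B_def by (intro sets.finite_UN pair_event_measurable) auto
  have "prob (B m) \<le> 2 ^ (m + 1) * u m" for m
  proof -
    have "prob (B m) \<le> (\<Sum>k\<in>{1..2 ^ (m + 1)}. prob (pair_event ({k} \<times> {1..2 * C * 2 ^ m}) (\<delta> * real (2 ^ m) powr \<alpha>)))"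
      unfolding B_def by (intro measure_UNION_le pair_event_measurable) auto
    also have "\<dots> = (\<Sum>k\<in>{1..2 ^ (m + 1) :: nat}. u m)"
      unfolding u_def by (intro sum.cong refl prob_pair_event_cong) auto
    finally show ?thesis by simp
  qed
  then have "summable (\<lambda>m. prob (B m))"
    by (intro summable_comparison_test'[OF su]) auto
  then show ?thesis
  proof (rule AE_eventually_dyadic[OF B])
    fix m n \<omega>
    assume \<omega>: "\<omega> \<in> space M" and n: "2 ^ m \<le> n" "n < 2 ^ (m + 1)"
      and "\<exists>k\<in>{1..n}. \<exists>i\<in>{1..p n}. \<exists>j\<in>{1..p n}. i \<noteq> j \<and> \<delta> * real n powr \<alpha> \<le> \<bar>X k i \<omega> * X k j \<omega>\<bar>"
    then obtain k i j where kij: "k \<in> {1..n}" "i \<in> {1..p n}" "j \<in> {1..p n}" "i \<noteq> j"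
      "\<delta> * real n powr \<alpha> \<le> \<bar>X k i \<omega> * X k j \<omega>\<bar>" by blast
    have "p n \<le> C * n" using p kij(1) by simp
    also have "\<dots> \<le> C * (2 * 2 ^ m)" using n by (intro mult_left_mono) auto
    finally have pn: "p n \<le> 2 * C * 2 ^ m" by simp
    have "real (2 ^ m) powr \<alpha> \<le> real n powr \<alpha>"
      using of_nat_mono[OF n(1), where 'a = real] \<alpha> by (intro powr_mono2) auto
    then have "\<delta> * real (2 ^ m) powr \<alpha> \<le> \<bar>X k i \<omega> * X k j \<omega>\<bar>"
      using kij(5) \<delta> mult_left_mono[of "real (2 ^ m) powr \<alpha>" "real n powr \<alpha>" \<delta>] by linarith
    then have "\<omega> \<in> pair_event ({k} \<times> {1..2 * C * 2 ^ m}) (\<delta> * real (2 ^ m) powr \<alpha>)"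
      unfolding pair_event_row using \<omega> kij pn by (intro CollectI conjI bexI[of _ i] bexI[of _ j]) auto
    moreover have "k \<in> {1..2 ^ (m + 1)}" using kij(1) n by auto
    ultimately show "\<omega> \<in> B m" unfolding B_def by blast
  qed
qed

text \<open>The same scheme for single entries. A block contains up to 2^(m+1) * 2 C 2^m entries, so
  its union bound carries the weight 4^m: one factor 2^m comes from the dyadic summation, the other
  from the factor n in the series.\<close>

lemma AE_entries_small:
  fixes p :: "nat \<Rightarrow> nat" and C :: nat
  assumes c: "c > 0"
    and summ: "summable (\<lambda>n. real n * prob {\<omega> \<in> space M. real n powr \<alpha> / c \<le> \<bar>X 1 1 \<omega>\<bar>})"
    and \<alpha>: "\<alpha> > 0" and \<delta>: "\<delta> > 0" and p: "\<And>n. n \<ge> 1 \<Longrightarrow> p n \<le> C * n"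
  shows "AE \<omega> in M. \<forall>\<^sub>F n in sequentially. \<not> (\<exists>k\<in>{1..n}. \<exists>i\<in>{1..p n}. \<delta> * real n powr \<alpha> \<le> \<bar>X k i \<omega>\<bar>)"
proof -
  obtain s where s: "\<And>m n. n \<le> 2 ^ (m + 2) \<Longrightarrow> 1 / c * real n powr \<alpha> \<le> \<delta> * real (2 ^ (m + s + 2)) powr \<alpha>"
    using dyadic_scale[OF \<alpha> \<delta>, of "1 / c"] c by auto
  define G where "G t = prob {\<omega> \<in> space M. t \<le> \<bar>X 1 1 \<omega>\<bar>}" for t
  define u where "u m = 2 ^ m * G (\<delta> * real (2 ^ m) powr \<alpha>)" for m :: nat
  have u0: "0 \<le> u m" for m by (simp add: u_def G_def)
  \<comment> \<open>The factor 2^m is a lower bound for the weight \<open>real n\<close> on the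
    block.\<close>
  define g where "g m = 2 ^ m * G (\<delta> * real (2 ^ (m + s + 2)) powr \<alpha>)" for m
  have "summable (\<lambda>m. 2 ^ m * g m)"
  proof (rule dyadic_summable[OF summ])
    fix m n :: nat assume n: "2 ^ (m + 1) < n" "n \<le> 2 ^ (m + 2)"
    have "(2::nat) ^ m \<le> n" using n by simp
    then have "(2::real) ^ m \<le> real n" using of_nat_mono[of "2 ^ m" n] by simp
    moreover have "G (\<delta> * real (2 ^ (m + s + 2)) powr \<alpha>) \<le> prob {\<omega> \<in> space M. real n powr \<alpha> / c \<le> \<bar>X 1 1 \<omega>\<bar>}"
      unfolding G_def
    proof (rule finite_measure_mono)
      show "{\<omega> \<in> space M. \<delta> * real (2 ^ (m + s + 2)) powr \<alpha> \<le> \<bar>X 1 1 \<omega>\<bar>}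
        \<subseteq> {\<omega> \<in> space M. real n powr \<alpha> / c \<le> \<bar>X 1 1 \<omega>\<bar>}"
        using s[OF n(2)] by auto
    qed measurable
    ultimately show "g m \<le> real n * prob {\<omega> \<in> space M. real n powr \<alpha> / c \<le> \<bar>X 1 1 \<omega>\<bar>}"
      unfolding g_def by (intro mult_mono) (auto simp: G_def)
  qed (auto simp: g_def G_def)
  then have "summable (\<lambda>m. (2 ^ (s + 2) * 2 ^ (s + 2) * 4 * real C) * (2 ^ m * g m))"
    by (rule summable_mult)
  moreover have "(2 ^ (s + 2) * 2 ^ (s + 2) * 4 * real C) * (2 ^ m * g m) = 4 * real C * 2 ^ (m + (s + 2)) * u (m + (s + 2))" for m
    by (simp add: g_def u_def power_add add.assoc)
  ultimately have "summable (\<lambda>m. 4 * real C * 2 ^ (m + (s + 2)) * u (m + (s + 2)))"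
    by (simp only:)
  then have su: "summable (\<lambda>m. 4 * real C * 2 ^ m * u m)"
    by (rule summable_iff_shift[of "\<lambda>m. 4 * real C * 2 ^ m * u m" "s + 2", THEN iffD1])
  define B where "B m = (\<Union>v\<in>{1..2 ^ (m + 1)} \<times> {1..2 * C * 2 ^ m}.
    {\<omega> \<in> space M. \<delta> * real (2 ^ m) powr \<alpha> \<le> \<bar>X (fst v) (snd v) \<omega>\<bar>})" for m :: nat
  have B: "B m \<in> events" for m unfolding B_def by (intro sets.finite_UN) auto
  have "prob (B m) \<le> 4 * real C * 2 ^ m * u m" for m
  proof -
    have "prob (B m) \<le> (\<Sum>v\<in>{1..2 ^ (m + 1)} \<times> {1..2 * C * 2 ^ m}.
        prob {\<omega> \<in> space M. \<delta> * real (2 ^ m) powr \<alpha> \<le> \<bar>X (fst v) (snd v) \<omega>\<bar>})"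
      unfolding B_def by (intro measure_UNION_le) auto
    also have "\<dots> = (\<Sum>v\<in>{1..2 ^ (m + 1) :: nat} \<times> {1..2 * C * 2 ^ m}. G (\<delta> * real (2 ^ m) powr \<alpha>))"
    proof (rule sum.cong[OF refl])
      fix v :: "nat \<times> nat" assume v: "v \<in> {1..2 ^ (m + 1)} \<times> {1..2 * C * 2 ^ m}"
      have "prob (X (fst v) (snd v) -` {x. \<delta> * real (2 ^ m) powr \<alpha> \<le> \<bar>x\<bar>} \<inter> space M)
          = prob (X 1 1 -` {x. \<delta> * real (2 ^ m) powr \<alpha> \<le> \<bar>x\<bar>} \<inter> space M)"
        by (rule prob_entry) (use v in auto)
      then show "prob {\<omega> \<in> space M. \<delta> * real (2 ^ m) powr \<alpha> \<le> \<bar>X (fst v) (snd v) \<omega>\<bar>} = G (\<delta> * real (2 ^ m) powr \<alpha>)"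
        by (simp add: G_def vimage_def Int_def conj_commute del: One_nat_def)
    qed
    also have "\<dots> = 4 * real C * 2 ^ m * u m"
      by (simp add: u_def card_cartesian_product)
    finally show ?thesis .
  qed
  then have "summable (\<lambda>m. prob (B m))"
    by (intro summable_comparison_test'[OF su]) auto
  then show ?thesis
  proof (rule AE_eventually_dyadic[OF B])
    fix m n \<omega>
    assume \<omega>: "\<omega> \<in> space M" and n: "2 ^ m \<le> n" "n < 2 ^ (m + 1)"
      and "\<exists>k\<in>{1..n}. \<exists>i\<in>{1..p n}. \<delta> * real n powr \<alpha> \<le> \<bar>X k i \<omega>\<bar>"
    then obtain k i where ki: "k \<in> {1..n}" "i \<in> {1..p n}" "\<delta> * real n powr \<alpha> \<le> \<bar>X k i \<omega>\<bar>" by blast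
    have "p n \<le> C * n" using p ki(1) by simp
    also have "\<dots> \<le> C * (2 * 2 ^ m)" using n by (intro mult_left_mono) auto
    finally have pn: "p n \<le> 2 * C * 2 ^ m" by simp
    have "real (2 ^ m) powr \<alpha> \<le> real n powr \<alpha>"
      using of_nat_mono[OF n(1), where 'a = real] \<alpha> by (intro powr_mono2) auto
    then have "\<delta> * real (2 ^ m) powr \<alpha> \<le> \<bar>X k i \<omega>\<bar>"
      using ki(3) \<delta> mult_left_mono[of "real (2 ^ m) powr \<alpha>" "real n powr \<alpha>" \<delta>] by linarith
    moreover have "(k, i) \<in> {1..2 ^ (m + 1)} \<times> {1..2 * C * 2 ^ m}" using ki n pn by auto
    ultimately show "\<omega> \<in> B m" unfolding B_def using \<omega> by force
  qed
qed

section \<open>Sums over rows, uniformly in the columns\<close>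

text \<open>There are at most (C n)^2 pairs of columns, each failing with probability at most 6 /
  n^4, so Borel--Cantelli applies. The smallness of the individual summands stays a premise inside
  the almost sure statement. The relation R selects the pairs: distinct columns for cross products,
  equal ones for sums along one column.\<close>

lemma AE_sums_over_rows_small:
  fixes p :: "nat \<Rightarrow> nat" and C :: nat and V \<alpha> \<epsilon> :: real
  assumes g [measurable]: "g \<in> borel_measurable (borel \<Otimes>\<^sub>M borel)"
    and mom: "\<And>k i j. R i j \<Longrightarrow> k \<ge> 1 \<Longrightarrow> i \<ge> 1 \<Longrightarrow> j \<ge> 1 \<Longrightarrow>
      integrable M (\<lambda>\<omega>. (g (X k i \<omega>, X k j \<omega>))\<^sup>2) \<and> expectation (\<lambda>\<omega>. g (X k i \<omega>, X k j \<omega>)) = 0 \<and>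
      expectation (\<lambda>\<omega>. (g (X k i \<omega>, X k j \<omega>))\<^sup>2) \<le> V"
    and \<alpha>: "1/2 < \<alpha>" and \<epsilon>: "0 < \<epsilon>" and p: "\<And>n. n \<ge> 1 \<Longrightarrow> p n \<le> C * n"
  shows "\<exists>\<delta>>0. AE \<omega> in M. \<forall>\<^sub>F n in sequentially. \<forall>i\<in>{1..p n}. \<forall>j\<in>{1..p n}. R i j \<longrightarrow>
    (\<forall>k\<in>{1..n}. \<bar>g (X k i \<omega>, X k j \<omega>)\<bar> \<le> \<delta> * real n powr \<alpha>) \<longrightarrow>
    \<bar>\<Sum>k=1..n. g (X k i \<omega>, X k j \<omega>)\<bar> < \<epsilon> * real n powr \<alpha>"
proof -
  obtain \<delta> where \<delta>: "\<delta> > 0" and tail: "\<forall>\<^sub>F n in sequentially. \<forall>Y. indep_vars (\<lambda>_. borel) Y {1..n} \<longrightarrow>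
    (\<forall>k\<in>{1..n}. integrable M (\<lambda>\<omega>. (Y k \<omega>)\<^sup>2) \<and> expectation (Y k) = 0 \<and>
      expectation (\<lambda>\<omega>. (Y k \<omega>)\<^sup>2) \<le> V) \<longrightarrow>
    prob {\<omega> \<in> space M. \<epsilon> * real n powr \<alpha> \<le> \<bar>\<Sum>k=1..n. Y k \<omega>\<bar> \<and>
      (\<forall>k\<in>{1..n}. \<bar>Y k \<omega>\<bar> \<le> \<delta> * real n powr \<alpha>)} \<le> 6 / real n ^ 4"
    using truncated_tail_bound[OF \<alpha> \<epsilon>, of V] by blast
  define E where "E n v = {\<omega> \<in> space M. \<epsilon> * real n powr \<alpha> \<le> \<bar>\<Sum>k=1..n. g (X k (fst v) \<omega>, X k (snd v) \<omega>)\<bar> \<and>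
      (\<forall>k\<in>{1..n}. \<bar>g (X k (fst v) \<omega>, X k (snd v) \<omega>)\<bar> \<le> \<delta> * real n powr \<alpha>)}" for n v
  define J where "J n = {v \<in> {1..p n} \<times> {1..p n}. R (fst v) (snd v)}" for n
  have E [measurable]: "E n v \<in> events" for n v unfolding E_def by measurable
  have J: "finite (J n)" for n by (simp add: J_def)
  have "\<forall>\<^sub>F n in sequentially. norm (prob (\<Union>v\<in>J n. E n v)) \<le> 6 * (real C)\<^sup>2 * (1 / real n ^ 2)"
    using tail eventually_ge_at_top[of 1]
  proof eventually_elim
    case (elim n)
    have "card (J n) \<le> card ({1..p n} \<times> {1..p n})" unfolding J_def by (rule card_mono) auto
    also have "\<dots> \<le> (C * n)\<^sup>2" using p[OF elim(2)] by (simp add: card_cartesian_product power2_eq_square mult_mono)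
    finally have cJ: "real (card (J n)) \<le> (real C * real n)\<^sup>2"
      using of_nat_mono[of "card (J n)" "(C * n)\<^sup>2", where 'a = real] by simp
    have "prob (\<Union>v\<in>J n. E n v) \<le> (\<Sum>v\<in>J n. prob (E n v))"
      by (intro measure_UNION_le J E)
    also have "\<dots> \<le> (\<Sum>v\<in>J n. 6 / real n ^ 4)"
    proof (rule sum_mono)
      fix v assume v: "v \<in> J n"
      show "prob (E n v) \<le> 6 / real n ^ 4"
        unfolding E_def
        using elim(1)[rule_format, of "\<lambda>k \<omega>. g (X k (fst v) \<omega>, X k (snd v) \<omega>)", OF indep_vars_rows[OF g]]
          mom[of "fst v" "snd v"] v
        by (auto simp: J_def)
    qed
    also have "\<dots> \<le> (real C * real n)\<^sup>2 * (6 / real n ^ 4)"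
      using cJ by (simp add: divide_right_mono)
    also have "\<dots> = 6 * (real C)\<^sup>2 * (1 / real n ^ 2)"
      using elim(2) by (simp add: field_simps power2_eq_square power4_eq_xxxx)
    finally show ?case by simp
  qed
  then have "summable (\<lambda>n. prob (\<Union>v\<in>J n. E n v))"
    by (rule summable_comparison_test_ev) (intro summable_mult, use inverse_power_summable[of 2, where 'a = real] in \<open>simp add: inverse_eq_divide\<close>)
  then have "AE \<omega> in M. \<forall>\<^sub>F n in sequentially. \<omega> \<in> space M - (\<Union>v\<in>J n. E n v)"
    using J by (intro borel_cantelli_AE1 sets.finite_UN E) (auto simp: emeasure_eq_measure)
  then have "AE \<omega> in M. \<forall>\<^sub>F n in sequentially. \<forall>i\<in>{1..p n}. \<forall>j\<in>{1..p n}. R i j \<longrightarrow>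
    (\<forall>k\<in>{1..n}. \<bar>g (X k i \<omega>, X k j \<omega>)\<bar> \<le> \<delta> * real n powr \<alpha>) \<longrightarrow>
    \<bar>\<Sum>k=1..n. g (X k i \<omega>, X k j \<omega>)\<bar> < \<epsilon> * real n powr \<alpha>"
  proof eventually_elim
    case (elim \<omega>)
    then show ?case
    proof eventually_elim
      case (elim n)
      show ?case
      proof (intro ballI impI, rule ccontr)
        fix i j assume ij: "i \<in> {1..p n}" "j \<in> {1..p n}" "R i j"
          and *: "\<forall>k\<in>{1..n}. \<bar>g (X k i \<omega>, X k j \<omega>)\<bar> \<le> \<delta> * real n powr \<alpha>"
            "\<not> \<bar>\<Sum>k=1..n. g (X k i \<omega>, X k j \<omega>)\<bar> < \<epsilon> * real n powr \<alpha>"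
        have "(i, j) \<in> J n" using ij by (simp add: J_def)
        moreover have "\<omega> \<in> E n (i, j)" using * elim by (simp add: E_def)
        ultimately show False using elim by blast
      qed
    qed
  qed
  then show ?thesis using \<delta> by blast
qed

text \<open>A law of large numbers uniform over the columns: centered indicators are bounded, so the
  sum bound with exponent 1 and deviation q / 2 applies, and frequencies eventually stay above half
  the probability.\<close>

lemma AE_frequency_ge:
  fixes p :: "nat \<Rightarrow> nat" and C :: nat
  assumes S [measurable]: "S \<in> sets borel" and pos: "0 < prob {\<omega> \<in> space M. X 1 1 \<omega> \<in> S}"
    and p: "\<And>n. n \<ge> 1 \<Longrightarrow> p n \<le> C * n"
  shows "AE \<omega> in M. \<forall>\<^sub>F n in sequentially. \<forall>i\<in>{1..p n}.
    prob {\<omega> \<in> space M. X 1 1 \<omega> \<in> S} / 2 * real n \<le> (\<Sum>k=1..n. indicator S (X k i \<omega>))"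
proof -
  define q where "q = prob {\<omega> \<in> space M. X 1 1 \<omega> \<in> S}"
  define h where "h x = indicator S x - q" for x :: real
  have h [measurable]: "h \<in> borel_measurable borel" unfolding h_def by measurable
  have q: "0 \<le> q" "q \<le> 1" by (simp_all add: q_def)
  have hb: "\<bar>h x\<bar> \<le> 1" for x using q by (auto simp: h_def indicator_def)
  have h2: "(h x)\<^sup>2 \<le> 1" for x using hb[of x] by (simp add: abs_square_le_1)
  have "expectation (\<lambda>\<omega>. h (X 1 1 \<omega>)) = expectation (indicator {\<omega> \<in> space M. X 1 1 \<omega> \<in> S}) - q"
  proof -
    have "expectation (\<lambda>\<omega>. h (X 1 1 \<omega>)) = expectation (\<lambda>\<omega>. indicator {\<omega> \<in> space M. X 1 1 \<omega> \<in> S} \<omega> - q)"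
      by (rule Bochner_Integration.integral_cong) (auto simp: h_def indicator_def)
    also have "\<dots> = expectation (indicator {\<omega> \<in> space M. X 1 1 \<omega> \<in> S}) - q"
      by (subst Bochner_Integration.integral_diff)
        (auto simp: prob_space emeasure_eq_measure simp del: One_nat_def intro!: integrable_real_indicator)
    finally show ?thesis .
  qed
  also have "\<dots> = 0" by (simp add: q_def)
  finally have h0: "expectation (\<lambda>\<omega>. h (X 1 1 \<omega>)) = 0" .
  have int2: "integrable M (\<lambda>\<omega>. (h (X k i \<omega>))\<^sup>2)" for k i
    by (rule integrable_const_bound[where B = 1]) (use h2 in auto)
  have V: "expectation (\<lambda>\<omega>. (h (X k i \<omega>))\<^sup>2) \<le> 1" for k i
    using integral_mono[OF int2 integrable_const[of 1] h2] by (simp add: prob_space)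
  \<comment> \<open>A function of one entry is viewed as a function of a pair with equal
    columns.\<close>
  define g :: "real \<times> real \<Rightarrow> real" where "g = (\<lambda>z. h (fst z))"
  have g [measurable]: "g \<in> borel_measurable (borel \<Otimes>\<^sub>M borel)" unfolding g_def by measurable
  obtain \<delta> where \<delta>: "\<delta> > 0" and ae: "AE \<omega> in M. \<forall>\<^sub>F n in sequentially. \<forall>i\<in>{1..p n}. \<forall>j\<in>{1..p n}. i = j \<longrightarrow>
    (\<forall>k\<in>{1..n}. \<bar>g (X k i \<omega>, X k j \<omega>)\<bar> \<le> \<delta> * real n powr 1) \<longrightarrow>
    \<bar>\<Sum>k=1..n. g (X k i \<omega>, X k j \<omega>)\<bar> < q / 2 * real n powr 1"
    using AE_sums_over_rows_small[OF g, of "(=)" 1 1 "q / 2" p C] int2 V p pos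
      entry_transfer(2)[OF h] h0
    by (auto simp: g_def q_def simp del: One_nat_def)
  \<comment> \<open>The summands are bounded by 1, so the smallness premise holds for all large
    n.\<close>
  have large: "\<forall>\<^sub>F n in sequentially. 1 \<le> \<delta> * real n"
    using \<delta> by real_asymp
  show ?thesis using ae
  proof eventually_elim
    case (elim \<omega>)
    then show ?case using large eventually_ge_at_top[of 1]
    proof eventually_elim
      case (elim n)
      show ?case
      proof
        fix i assume i: "i \<in> {1..p n}"
        have "\<forall>k\<in>{1..n}. \<bar>g (X k i \<omega>, X k i \<omega>)\<bar> \<le> \<delta> * real n powr 1"
          using hb elim(2,3) by (auto simp: g_def intro: order_trans)
        then have "\<bar>\<Sum>k=1..n. h (X k i \<omega>)\<bar> < q / 2 * real n"
          using elim(1,3) i by (auto simp: g_def)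
        then have "\<bar>(\<Sum>k=1..n. indicator S (X k i \<omega>)) - real n * q\<bar> < q / 2 * real n"
          by (simp add: h_def sum_subtractf)
        then show "prob {\<omega> \<in> space M. X 1 1 \<omega> \<in> S} / 2 * real n \<le> (\<Sum>k=1..n. indicator S (X k i \<omega>))"
          unfolding q_def[symmetric] abs_less_iff by argo
      qed
    qed
  qed
qed

text \<open>Every centre m is at distance at least (b - a) / 2 from all points below a or from all
  points above b, and each of these two half-lines is visited by a positive fraction of the rows.
  The bound holds for all m simultaneously, so the random sample mean may be inserted.\<close>

lemma AE_scatter_ge:
  fixes p :: "nat \<Rightarrow> nat" and C :: nat
  assumes int: "integrable M (X 1 1)" and nondeg: "\<not> (\<exists>c. AE \<omega> in M. X 1 1 \<omega> = c)"
    and p: "\<And>n. n \<ge> 1 \<Longrightarrow> p n \<le> C * n"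
  shows "\<exists>\<kappa>>0. AE \<omega> in M. \<forall>\<^sub>F n in sequentially. \<forall>i\<in>{1..p n}. \<forall>m.
    \<kappa> * real n \<le> (\<Sum>k=1..n. (X k i \<omega> - m)\<^sup>2)"
proof -
  obtain a b where ab: "a < b" and qa: "0 < prob {\<omega> \<in> space M. X 1 1 \<omega> \<le> a}"
    and qb: "0 < prob {\<omega> \<in> space M. b \<le> X 1 1 \<omega>}"
    using nondegenerate_gap[OF int nondeg] .
  define q where "q = min (prob {\<omega> \<in> space M. X 1 1 \<omega> \<le> a}) (prob {\<omega> \<in> space M. b \<le> X 1 1 \<omega>})"
  define d where "d = (b - a) / 2"
  have q: "q > 0" and d: "d > 0" using ab qa qb by (simp_all add: q_def d_def)
  have freq: "AE \<omega> in M. \<forall>\<^sub>F n in sequentially. \<forall>i\<in>{1..p n}. q / 2 * real n \<le> (\<Sum>k=1..n. indicator S (X k i \<omega>))"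
    if S: "S \<in> sets borel" and qS: "q \<le> prob {\<omega> \<in> space M. X 1 1 \<omega> \<in> S}" for S
  proof -
    have "0 < prob {\<omega> \<in> space M. X 1 1 \<omega> \<in> S}" using q qS by linarith
    then have "AE \<omega> in M. \<forall>\<^sub>F n in sequentially. \<forall>i\<in>{1..p n}.
        prob {\<omega> \<in> space M. X 1 1 \<omega> \<in> S} / 2 * real n \<le> (\<Sum>k=1..n. indicator S (X k i \<omega>))"
      by (rule AE_frequency_ge[OF S, of p C]) (rule p)
    then show ?thesis
    proof eventually_elim
      case (elim \<omega>)
      then show ?case
      proof eventually_elim
        case (elim n)
        have "q / 2 * real n \<le> prob {\<omega> \<in> space M. X 1 1 \<omega> \<in> S} / 2 * real n"
          using qS by (intro mult_right_mono) auto
        then show ?case using elim by (meson order_trans)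
      qed
    qed
  qed
  have "AE \<omega> in M. \<forall>\<^sub>F n in sequentially. \<forall>i\<in>{1..p n}. q / 2 * real n \<le> (\<Sum>k=1..n. indicator {..a} (X k i \<omega>))"
    by (rule freq) (auto simp: q_def)
  moreover have "AE \<omega> in M. \<forall>\<^sub>F n in sequentially. \<forall>i\<in>{1..p n}. q / 2 * real n \<le> (\<Sum>k=1..n. indicator {b..} (X k i \<omega>))"
    by (rule freq) (auto simp: q_def)
  ultimately have "AE \<omega> in M. \<forall>\<^sub>F n in sequentially. \<forall>i\<in>{1..p n}. \<forall>m.
    d\<^sup>2 * q / 2 * real n \<le> (\<Sum>k=1..n. (X k i \<omega> - m)\<^sup>2)"
  proof eventually_elim
    case (elim \<omega>)
    then show ?case
    proof eventually_elim
      case (elim n)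
      show ?case
      proof (intro ballI allI)
        fix i m assume i: "i \<in> {1..p n}"
        have *: "d\<^sup>2 * q / 2 * real n \<le> (\<Sum>k=1..n. (X k i \<omega> - m)\<^sup>2)"
          if S: "q / 2 * real n \<le> (\<Sum>k=1..n. indicator S (X k i \<omega>))" "\<And>x. x \<in> S \<Longrightarrow> d \<le> \<bar>x - m\<bar>" for S
        proof -
          have "d\<^sup>2 * (q / 2 * real n) \<le> d\<^sup>2 * (\<Sum>k=1..n. indicator S (X k i \<omega>))"
            using S(1) by (rule mult_left_mono) simp
          also have "\<dots> \<le> (\<Sum>k=1..n. (X k i \<omega> - m)\<^sup>2)"
            unfolding sum_distrib_left
          proof (rule sum_mono)
            fix k
            show "d\<^sup>2 * indicator S (X k i \<omega>) \<le> (X k i \<omega> - m)\<^sup>2"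
              using power_mono[OF S(2)[of "X k i \<omega>"], of 2] d by (simp add: indicator_def)
          qed
          finally show ?thesis by simp
        qed
        show "d\<^sup>2 * q / 2 * real n \<le> (\<Sum>k=1..n. (X k i \<omega> - m)\<^sup>2)"
        \<comment> \<open>A centre to the right of the midpoint is far from the lower half-line,
          otherwise from the upper one.\<close>
        proof (cases "m \<ge> (a + b) / 2")
          case True
          then show ?thesis using elim(1) i by (intro *[of "{..a}"]) (auto simp: d_def field_simps abs_if)
        next
          case False
          then show ?thesis using elim(2) i by (intro *[of "{b..}"]) (auto simp: d_def field_simps abs_if)
        qed
      qed
    qed
  qed
  then show ?thesis using q d by (intro exI[of _ "d\<^sup>2 * q / 2"]) simp
qed

section \<open>Numerators, denominators and the limit of the maximal correlation\<close>

context
  fixes p :: "nat \<Rightarrow> nat" and C :: nat and \<alpha> c :: real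
  assumes p: "\<And>n. n \<ge> 1 \<Longrightarrow> p n \<le> C * n"
    and \<alpha>: "1/2 < \<alpha>" "\<alpha> \<le> 1"
    and summ: "summable (\<lambda>n. prob (pair_event ({1} \<times> {1..n}) (real n powr \<alpha>)))"
    and c: "c > 0" "prob {\<omega> \<in> space M. c \<le> \<bar>X 1 1 \<omega>\<bar>} > 0"
begin

lemma square_integrable: "integrable M (\<lambda>\<omega>. (X 1 1 \<omega>)\<^sup>2)"
  by (rule square_integrable_entry[OF c(1) \<alpha>(2) tail_summable[OF c summ]])

lemma integrable_entry: "integrable M (X 1 1)"
  by (rule square_integrable_imp_integrable[OF X_measurable square_integrable])

lemma integrable_centered_square: "integrable M (\<lambda>\<omega>. (X 1 1 \<omega> - \<mu>)\<^sup>2)"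
  using square_integrable integrable_entry by (simp add: power2_diff)

lemma AE_centered_entries_small:
  assumes \<delta>: "\<delta> > 0"
  shows "AE \<omega> in M. \<forall>\<^sub>F n in sequentially. \<forall>k\<in>{1..n}. \<forall>i\<in>{1..p n}. \<bar>X k i \<omega> - \<mu>\<bar> \<le> \<delta> * real n powr \<alpha>"
proof -
  have "\<alpha> > 0" using \<alpha> by simp
  have "AE \<omega> in M. \<forall>\<^sub>F n in sequentially.
      \<not> (\<exists>k\<in>{1..n}. \<exists>i\<in>{1..p n}. \<delta> / 2 * real n powr \<alpha> \<le> \<bar>X k i \<omega>\<bar>)"
    using \<delta> by (intro AE_entries_small[OF c(1) tail_summable[OF c summ] \<open>\<alpha> > 0\<close> _ p]) auto
  then show ?thesis
  proof eventually_elim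
    case (elim \<omega>)
    \<comment> \<open>The level tends to infinity, so half of it eventually absorbs the constant
      \<mu>; the other half bounds the entry.\<close>
    have "\<forall>\<^sub>F n in sequentially. \<bar>\<mu>\<bar> \<le> \<delta> / 2 * real n powr \<alpha>"
      using \<delta> \<open>\<alpha> > 0\<close> by real_asymp
    with elim show ?case
    proof eventually_elim
      case (elim n)
      show ?case
      proof (intro ballI)
        fix k i assume "k \<in> {1..n}" "i \<in> {1..p n}"
        then have "\<bar>X k i \<omega>\<bar> < \<delta> / 2 * real n powr \<alpha>" using elim(1) by force
        then show "\<bar>X k i \<omega> - \<mu>\<bar> \<le> \<delta> * real n powr \<alpha>" using elim(2) by linarith
      qed
    qed
  qed
qed

text \<open>Multiplying out gives the raw product, two terms \<mu> times an entry and \<mu>^2; each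
  is eventually at most a quarter of the level.\<close>

lemma AE_centered_products_small:
  assumes \<delta>: "\<delta> > 0"
  shows "AE \<omega> in M. \<forall>\<^sub>F n in sequentially. \<forall>k\<in>{1..n}. \<forall>i\<in>{1..p n}. \<forall>j\<in>{1..p n}. i \<noteq> j \<longrightarrow>
    \<bar>(X k i \<omega> - \<mu>) * (X k j \<omega> - \<mu>)\<bar> \<le> \<delta> * real n powr \<alpha>"
proof -
  have "\<alpha> > 0" using \<alpha> by simp
  \<comment> \<open>The level for single entries, chosen so that multiplication by \<mu> leaves at
    most \<delta> / 4; adding 1 covers \<mu> = 0.\<close>
  define d where "d = \<delta> / (4 * (\<bar>\<mu>\<bar> + 1))"
  have d: "d > 0" "\<bar>\<mu>\<bar> * d \<le> \<delta> / 4" using \<delta> by (auto simp: d_def field_simps)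
  have "AE \<omega> in M. \<forall>\<^sub>F n in sequentially. \<not> (\<exists>k\<in>{1..n}. \<exists>i\<in>{1..p n}. \<exists>j\<in>{1..p n}.
      i \<noteq> j \<and> \<delta> / 4 * real n powr \<alpha> \<le> \<bar>X k i \<omega> * X k j \<omega>\<bar>)"
    using \<delta> by (intro AE_products_small[OF summ \<open>\<alpha> > 0\<close> _ p]) auto
  moreover have "AE \<omega> in M. \<forall>\<^sub>F n in sequentially. \<forall>k\<in>{1..n}. \<forall>i\<in>{1..p n}. \<bar>X k i \<omega> - 0\<bar> \<le> d * real n powr \<alpha>"
    using d(1) by (rule AE_centered_entries_small)
  ultimately show ?thesis
  proof eventually_elim
    case (elim \<omega>)
    have "\<forall>\<^sub>F n in sequentially. \<mu>\<^sup>2 \<le> \<delta> / 4 * real n powr \<alpha>"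
      using \<delta> \<open>\<alpha> > 0\<close> by real_asymp
    with elim show ?case
    proof eventually_elim
      case (elim n)
      show ?case
      proof (intro ballI impI)
        fix k i j assume kij: "k \<in> {1..n}" "i \<in> {1..p n}" "j \<in> {1..p n}" "i \<noteq> j"
        let ?t = "real n powr \<alpha>"
        have "\<bar>X k i \<omega> * X k j \<omega>\<bar> < \<delta> / 4 * ?t" using elim(1) kij by force
        moreover have "\<bar>\<mu> * X k l \<omega>\<bar> \<le> \<delta> / 4 * ?t" if "l \<in> {1..p n}" for l
        proof -
          have "\<bar>\<mu> * X k l \<omega>\<bar> \<le> \<bar>\<mu>\<bar> * (d * ?t)"
            unfolding abs_mult using elim(2) kij(1) that by (intro mult_left_mono) auto
          also have "\<dots> \<le> \<delta> / 4 * ?t"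
            using mult_right_mono[OF d(2), of ?t] by (simp add: mult.assoc)
          finally show ?thesis .
        qed
        from this[OF kij(2)] this[OF kij(3)]
        have "\<bar>\<mu> * X k i \<omega>\<bar> \<le> \<delta> / 4 * ?t" "\<bar>\<mu> * X k j \<omega>\<bar> \<le> \<delta> / 4 * ?t" .
        moreover have "(X k i \<omega> - \<mu>) * (X k j \<omega> - \<mu>) = X k i \<omega> * X k j \<omega> - \<mu> * X k i \<omega> - \<mu> * X k j \<omega> + \<mu>\<^sup>2"
          by (simp add: algebra_simps power2_eq_square)
        moreover have "\<delta> * ?t = 4 * (\<delta> / 4 * ?t)" by simp
        ultimately show "\<bar>(X k i \<omega> - \<mu>) * (X k j \<omega> - \<mu>)\<bar> \<le> \<delta> * ?t"
          using elim(3) zero_le_power2[of \<mu>] by linarith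
      qed
    qed
  qed
qed

lemma AE_cross_sums_small:
  assumes e: "e > 0" and \<mu>: "\<mu> = expectation (X 1 1)"
  shows "AE \<omega> in M. \<forall>\<^sub>F n in sequentially. \<forall>i\<in>{1..p n}. \<forall>j\<in>{1..p n}. i \<noteq> j \<longrightarrow>
    \<bar>\<Sum>k=1..n. (X k i \<omega> - \<mu>) * (X k j \<omega> - \<mu>)\<bar> \<le> e * real n powr \<alpha>"
proof -
  define g :: "real \<times> real \<Rightarrow> real" where "g = (\<lambda>z. (fst z - \<mu>) * (snd z - \<mu>))"
  have g [measurable]: "g \<in> borel_measurable (borel \<Otimes>\<^sub>M borel)" unfolding g_def by measurable
  \<comment> \<open>The second moment of a product of two independent centered entries is the square
    of the variance.\<close>
  define V where "V = (expectation (\<lambda>\<omega>. (X 1 1 \<omega> - \<mu>)\<^sup>2))\<^sup>2"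
  have "expectation (\<lambda>\<omega>. X 1 1 \<omega> - \<mu>) = 0" using integrable_entry \<mu> by (simp add: prob_space)
  then have mom: "integrable M (\<lambda>\<omega>. (g (X k i \<omega>, X k j \<omega>))\<^sup>2) \<and> expectation (\<lambda>\<omega>. g (X k i \<omega>, X k j \<omega>)) = 0 \<and>
      expectation (\<lambda>\<omega>. (g (X k i \<omega>, X k j \<omega>))\<^sup>2) \<le> V"
    if "i \<noteq> j" "k \<ge> 1" "i \<ge> 1" "j \<ge> 1" for k i j
    using that expectation_prod_entries[of "\<lambda>x. x - \<mu>" k i j] integrable_entry
      expectation_prod_entries[of "\<lambda>x. (x - \<mu>)\<^sup>2" k i j] integrable_centered_square[of \<mu>]
    by (simp add: g_def V_def power_mult_distrib del: One_nat_def)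
  obtain \<delta> where \<delta>: "\<delta> > 0" and ae: "AE \<omega> in M. \<forall>\<^sub>F n in sequentially. \<forall>i\<in>{1..p n}. \<forall>j\<in>{1..p n}. i \<noteq> j \<longrightarrow>
    (\<forall>k\<in>{1..n}. \<bar>g (X k i \<omega>, X k j \<omega>)\<bar> \<le> \<delta> * real n powr \<alpha>) \<longrightarrow>
    \<bar>\<Sum>k=1..n. g (X k i \<omega>, X k j \<omega>)\<bar> < e * real n powr \<alpha>"
    using AE_sums_over_rows_small[where R = "\<lambda>i j. i \<noteq> j" and p = p and C = C, OF g mom \<alpha>(1) e p] by blast
  show ?thesis
    using ae AE_centered_products_small[OF \<delta>, of \<mu>]
  proof eventually_elim
    case (elim \<omega>)
    then show ?case by eventually_elim (auto simp: g_def less_imp_le)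
  qed
qed

lemma AE_column_sums_small:
  assumes e: "e > 0" and \<mu>: "\<mu> = expectation (X 1 1)"
  shows "AE \<omega> in M. \<forall>\<^sub>F n in sequentially. \<forall>i\<in>{1..p n}. \<bar>\<Sum>k=1..n. X k i \<omega> - \<mu>\<bar> \<le> e * real n powr \<alpha>"
proof -
  define g :: "real \<times> real \<Rightarrow> real" where "g = (\<lambda>z. fst z - \<mu>)"
  have g [measurable]: "g \<in> borel_measurable (borel \<Otimes>\<^sub>M borel)" unfolding g_def by measurable
  define V where "V = expectation (\<lambda>\<omega>. (X 1 1 \<omega> - \<mu>)\<^sup>2)"
  have "expectation (\<lambda>\<omega>. X 1 1 \<omega> - \<mu>) = 0" using integrable_entry \<mu> by (simp add: prob_space)
  then have mom: "integrable M (\<lambda>\<omega>. (g (X k i \<omega>, X k j \<omega>))\<^sup>2) \<and> expectation (\<lambda>\<omega>. g (X k i \<omega>, X k j \<omega>)) = 0 \<and>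
      expectation (\<lambda>\<omega>. (g (X k i \<omega>, X k j \<omega>))\<^sup>2) \<le> V"
    if "i = j" "k \<ge> 1" "i \<ge> 1" "j \<ge> 1" for k i j
    using that entry_transfer(2)[of "\<lambda>x. x - \<mu>" k i] entry_transfer[of "\<lambda>x. (x - \<mu>)\<^sup>2" k i]
      integrable_centered_square[of \<mu>]
    by (auto simp: g_def V_def simp del: One_nat_def)
  obtain \<delta> where \<delta>: "\<delta> > 0" and ae: "AE \<omega> in M. \<forall>\<^sub>F n in sequentially. \<forall>i\<in>{1..p n}. \<forall>j\<in>{1..p n}. i = j \<longrightarrow>
    (\<forall>k\<in>{1..n}. \<bar>g (X k i \<omega>, X k j \<omega>)\<bar> \<le> \<delta> * real n powr \<alpha>) \<longrightarrow>
    \<bar>\<Sum>k=1..n. g (X k i \<omega>, X k j \<omega>)\<bar> < e * real n powr \<alpha>"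
    using AE_sums_over_rows_small[where R = "(=)" and p = p and C = C, OF g mom \<alpha>(1) e p] by blast
  show ?thesis
    using ae AE_centered_entries_small[OF \<delta>, of \<mu>]
  proof eventually_elim
    case (elim \<omega>)
    then show ?case by eventually_elim (auto simp: g_def less_imp_le)
  qed
qed

text \<open>On one almost sure event the bounds for cross sums, column sums and scatter hold for all
  pairs of columns at once, so the deterministic estimate of a single coefficient carries over to
  the maximum.\<close>

lemma AE_max_corr_le:
  assumes e: "e > 0" and \<kappa>: "\<kappa> > 0"
    and scatter: "AE \<omega> in M. \<forall>\<^sub>F n in sequentially. \<forall>i\<in>{1..p n}. \<forall>m.
      \<kappa> * real n \<le> (\<Sum>k=1..n. (X k i \<omega> - m)\<^sup>2)"
  shows "AE \<omega> in M. \<forall>\<^sub>F n in sequentially.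
    real n powr (1 - \<alpha>) * max_corr (\<lambda>k i. X k i \<omega>) n (p n) \<le> (e + e\<^sup>2) / \<kappa>"
  using scatter AE_cross_sums_small[OF e refl] AE_column_sums_small[OF e refl]
proof eventually_elim
  case (elim \<omega>)
  then show ?case using eventually_ge_at_top[of 1]
  proof eventually_elim
    case (elim n)
    have "\<bar>pearson (\<lambda>k i. X k i \<omega>) n i j\<bar> \<le> (e + e\<^sup>2) / \<kappa> / real n powr (1 - \<alpha>)"
      if ij: "1 \<le> i" "i < j" "j \<le> p n" for i j
    proof -
      have "real n powr (1 - \<alpha>) * \<bar>pearson (\<lambda>k i. X k i \<omega>) n i j\<bar> \<le> (e + e\<^sup>2) / \<kappa>"
        by (rule pearson_bound[where \<mu> = "expectation (X 1 1)", OF elim(4) \<kappa> \<alpha>(2)])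
          (use elim(1-3) ij in auto)
      then show ?thesis using elim(4) by (subst pos_le_divide_eq) (auto simp: mult.commute)
    qed
    then have "max_corr (\<lambda>k i. X k i \<omega>) n (p n) \<le> (e + e\<^sup>2) / \<kappa> / real n powr (1 - \<alpha>)"
      using e \<kappa> by (intro max_corr_le) auto
    moreover have "real n powr (1 - \<alpha>) > 0" using elim(4) by simp
    ultimately show ?case by (simp only: pos_le_divide_eq mult.commute)
  qed
qed

text \<open>The constant \<kappa> is fixed before e, so the bound (e + e^2) / \<kappa> can be made
  arbitrarily small. Letting e run through the sequence 1 / (r + 1) keeps the exceptional null sets
  countable in number.\<close>

lemma AE_max_corr_tendsto_0:
  assumes nondeg: "\<not> (\<exists>c. AE \<omega> in M. X 1 1 \<omega> = c)"
  shows "AE \<omega> in M. (\<lambda>n. real n powr (1 - \<alpha>) * max_corr (\<lambda>k i. X k i \<omega>) n (p n)) \<longlonglongrightarrow> 0"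
proof -
  obtain \<kappa> where \<kappa>: "\<kappa> > 0" and scatter: "AE \<omega> in M. \<forall>\<^sub>F n in sequentially. \<forall>i\<in>{1..p n}. \<forall>m.
      \<kappa> * real n \<le> (\<Sum>k=1..n. (X k i \<omega> - m)\<^sup>2)"
    using AE_scatter_ge[OF integrable_entry nondeg, of p C] p by blast
  define e where "e r = 1 / (real r + 1)" for r :: nat
  have "AE \<omega> in M. \<forall>r. \<forall>\<^sub>F n in sequentially.
    real n powr (1 - \<alpha>) * max_corr (\<lambda>k i. X k i \<omega>) n (p n) \<le> (e r + (e r)\<^sup>2) / \<kappa>"
    unfolding AE_all_countable using \<kappa> scatter by (intro allI AE_max_corr_le) (auto simp: e_def)
  then show ?thesis
  proof eventually_elim
    case (elim \<omega>)
    show ?case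
    proof (rule tendstoI)
      fix \<eta> :: real assume "\<eta> > 0"
      have "(\<lambda>r. (e r + (e r)\<^sup>2) / \<kappa>) \<longlonglongrightarrow> 0" unfolding e_def using \<kappa> by real_asymp
      then have "\<forall>\<^sub>F r in sequentially. (e r + (e r)\<^sup>2) / \<kappa> < \<eta>" using \<open>\<eta> > 0\<close> by (rule order_tendstoD)
      then obtain r where r: "(e r + (e r)\<^sup>2) / \<kappa> < \<eta>" by (auto simp: eventually_sequentially)
      show "\<forall>\<^sub>F n in sequentially. dist (real n powr (1 - \<alpha>) * max_corr (\<lambda>k i. X k i \<omega>) n (p n)) 0 < \<eta>"
        using elim[rule_format, of r]
        by eventually_elim (use r in \<open>auto simp: max_corr_nonneg abs_mult\<close>)
    qed
  qed
qed

end

end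

theorem theorem2p2:
  fixes M :: "'a measure" and X :: "nat \<Rightarrow> nat \<Rightarrow> 'a \<Rightarrow> real"
    and p :: "nat \<Rightarrow> nat" and \<alpha> :: real
  assumes "prob_space M"
    and meas: "\<And>k i. X k i \<in> borel_measurable M"
    and indep: "prob_space.indep_vars M (\<lambda>_. borel) (\<lambda>(k, i). X k i) ({1..} \<times> {1..})"
    and ident: "\<And>k i. k \<ge> 1 \<Longrightarrow> i \<ge> 1 \<Longrightarrow> distr M borel (X k i) = distr M borel (X 1 1)"
    and p_pos: "\<And>n. n \<ge> 1 \<Longrightarrow> p n \<ge> 1"
    and p_ratio: "\<exists>c1 c2. 0 < c1 \<and> (\<forall>n\<ge>1. c1 \<le> real n / real (p n) \<and> real n / real (p n) \<le> c2)"
    and alpha: "1/2 < \<alpha>" "\<alpha> \<le> 1"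
    and nondeg: "\<not> (\<exists>c. AE \<omega> in M. X 1 1 \<omega> = c)"
    and summ: "summable (\<lambda>n. measure M {\<omega> \<in> space M.
                 \<exists>i j. 1 \<le> i \<and> i < j \<and> j \<le> n \<and> \<bar>X 1 i \<omega> * X 1 j \<omega>\<bar> \<ge> real n powr \<alpha>})"
  shows "AE \<omega> in M. (\<lambda>n. real n powr (1 - \<alpha>) * max_corr (\<lambda>k i. X k i \<omega>) n (p n)) \<longlonglongrightarrow> 0"
proof -
  interpret prob_space M by fact
  interpret iid_array M X
    by unfold_locales (fact meas, fact indep, fact ident)
  obtain c1 where c1: "0 < c1" "\<And>n. n \<ge> 1 \<Longrightarrow> c1 \<le> real n / real (p n)"
    using p_ratio by blast
  \<comment> \<open>The lower bound on n / p n means that the number of columns grows at most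
    linearly; rounding up 1 / c1 gives an integer constant C.\<close>
  have p: "p n \<le> nat \<lceil>1 / c1\<rceil> * n" if n: "n \<ge> 1" for n
  proof -
    have "c1 * real (p n) \<le> real n" using c1(2)[OF n] p_pos[OF n] by (simp add: pos_le_divide_eq)
    then have "real (p n) \<le> 1 / c1 * real n" using c1(1) by (simp add: field_simps)
    also have "\<dots> \<le> real (nat \<lceil>1 / c1\<rceil>) * real n" by (intro mult_right_mono real_nat_ceiling_ge) auto
    finally have "real (p n) \<le> real (nat \<lceil>1 / c1\<rceil> * n)" by simp
    then show ?thesis by (simp only: of_nat_le_iff)
  qed
  have "{\<omega> \<in> space M. \<exists>i j. 1 \<le> i \<and> i < j \<and> j \<le> n \<and> \<bar>X 1 i \<omega> * X 1 j \<omega>\<bar> \<ge> real n powr \<alpha>}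
      = pair_event ({1} \<times> {1..n}) (real n powr \<alpha>)" (is "?L n = _") for n
  proof
    show "?L n \<subseteq> pair_event ({1} \<times> {1..n}) (real n powr \<alpha>)"
    proof
      fix \<omega> assume "\<omega> \<in> ?L n"
      then obtain i j where "\<omega> \<in> space M" "1 \<le> i" "i < j" "j \<le> n" "real n powr \<alpha> \<le> \<bar>X 1 i \<omega> * X 1 j \<omega>\<bar>"
        by blast
      then show "\<omega> \<in> pair_event ({1} \<times> {1..n}) (real n powr \<alpha>)"
        unfolding pair_event_row by (intro CollectI conjI bexI[of _ i] bexI[of _ j]) auto
    qed
    show "pair_event ({1} \<times> {1..n}) (real n powr \<alpha>) \<subseteq> ?L n"
    proof
      fix \<omega> assume "\<omega> \<in> pair_event ({1} \<times> {1..n}) (real n powr \<alpha>)"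
      then have \<omega>: "\<omega> \<in> space M" and
        "\<exists>i\<in>{1..n}. \<exists>j\<in>{1..n}. i \<noteq> j \<and> real n powr \<alpha> \<le> \<bar>X 1 i \<omega> * X 1 j \<omega>\<bar>"
        unfolding pair_event_row by blast+
      then obtain i j where "i \<in> {1..n}" "j \<in> {1..n}" "i < j" "real n powr \<alpha> \<le> \<bar>X 1 i \<omega> * X 1 j \<omega>\<bar>"
        \<comment> \<open>The product is symmetric, so two distinct indices can be put in increasing
          order.\<close>
        by (metis mult.commute nat_neq_iff)
      then show "\<omega> \<in> ?L n"
        using \<omega> by (intro CollectI conjI exI[of _ i] exI[of _ j]) auto
    qed
  qed
  then have s: "summable (\<lambda>n. prob (pair_event ({1} \<times> {1..n}) (real n powr \<alpha>)))"
    using summ by simp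
  \<comment> \<open>A nondegenerate entry is not almost surely zero, so some level c > 0 is reached
    with positive probability; this c is the fixed level in the comparison of products with
    tails.\<close>
  have "\<not> (AE \<omega> in M. \<bar>X 1 1 \<omega>\<bar> \<le> 0)" using nondeg by auto
  then obtain c where "c > 0" "0 < prob {\<omega> \<in> space M. c \<le> \<bar>X 1 1 \<omega>\<bar>}"
    using exists_prob_ge_pos[of "\<lambda>\<omega>. \<bar>X 1 1 \<omega>\<bar>"] by auto
  from AE_max_corr_tendsto_0[OF p alpha s this nondeg] show ?thesis .
qed

end
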